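(* Let $\mathbb{H}^n$ be the Heisenberg group, $\Omega\subset\mathbb{H}^n$ an open set, $1<p<\infty$ and $\lambda\in\mathbb{R}$. Let $v$ be a positive sub-solution of $$-\nabla_H\cdot(|\nabla_H u|^{p-2}\nabla_H u)=\lambda|u|^{p-2}u\ \text{ in }\Omega,\qquad u=0\ \text{ on }\partial\Omega.$$ Then for every fixed $q>p-1$ we have $$\int_{\Omega}v^{q-p}\phi^p|\nabla_H v|^p\,dx\le\left(\frac{p}{q-p+1}\right)^p\int_\Omega v^q|\nabla_H\phi|^p\,dx+\frac{\lambda p}{q-p+1}\int_\Omega v^q\phi^p\,dx,$$ and for $q=p$ and $\lambda=0$ we have $$\int_\Omega\phi^p|\nabla_H v|^p\,dx\le p^p\int_\Omega v^p|\nabla_H\phi|^p\,dx,$$ for all nonnegative functions $\phi\in C_0^\infty(\Omega)$.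
   Context: The Heisenberg group $\mathbb{H}^n$ is $\mathbb{R}^{2n+1}$, with points $\xi=(x,y,t)$, $x,y\in\mathbb{R}^n$, $t\in\mathbb{R}$, equipped with the group law $\xi\circ\xi'=(x+x',y+y',t+t'+2(x\cdot y'-x'\cdot y))$. In the integrals $dx$ denotes Lebesgue measure on $\mathbb{R}^{2n+1}$. The vector fields are $$X_j=\frac{\partial}{\partial x_j}+2y_j\frac{\partial}{\partial t},\qquad Y_j=\frac{\partial}{\partial y_j}-2x_j\frac{\partial}{\partial t},\qquad j=1,\dots,n,$$ and the horizontal gradient is $\nabla_H=(X_1,\dots,X_n,Y_1,\dots,Y_n)$. Here $\langle\cdot,\cdot\rangle$ is the Euclidean inner product on $\mathbb{R}^{2n}$, $|\nabla_H u|=\langle\nabla_H u,\nabla_H u\rangle^{1/2}$, and $\nabla_H\cdot(F_1,\dots,F_{2n})=\sum_{j=1}^n (X_jF_j+Y_jF_{n+j})$. $\mathring{S}^{1,p}(\Omega)$ is the completion of $C_0^1(\Omega)$ in the norm $\left(\int_\Omega|\nabla_H u|^p dx\right)^{1/p}$; functions are real-valued. A sub-solution of the Dirichlet problem (with parameter $\lambda$) is a function $u\in\mathring{S}^{1,p}(\Omega)$ such that $$\int_\Omega|\nabla_H u|^{p-2}\langle\nabla_H u,\nabla_H\phi\rangle dx-\lambda\int_\Omega|u|^{p-2}u\phi\,dx\le 0$$ for all nonnegative $\phi\in\mathring{S}^{1,p}(\Omega)$. *)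

theory Defs
  imports "HOL-Analysis.Analysis"
begin

text \<open>
  The underlying space of the Heisenberg group of dimension \<open>2n + 1\<close>, \<open>n = CARD('n)\<close>; a point is
  \<open>(x, y, t)\<close>.  The group law enters below only through the left-invariant fields \<open>X\<^sub>j\<close> and \<open>Y\<^sub>j\<close>.
\<close>

type_synonym 'n heis = "(real ^ 'n) \<times> (real ^ 'n) \<times> real"

type_synonym 'n hvec = "(real ^ 'n) \<times> (real ^ 'n)"

definition partial_deriv :: "'a::euclidean_space \<Rightarrow> ('a \<Rightarrow> real) \<Rightarrow> 'a \<Rightarrow> real" where
  "partial_deriv b f \<xi> = frechet_derivative f (at \<xi>) b"

definition X_field :: "'n::finite \<Rightarrow> ('n heis \<Rightarrow> real) \<Rightarrow> 'n heis \<Rightarrow> real" where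
  "X_field j f = (\<lambda>(x, y, t).
     partial_deriv (axis j 1, 0, 0) f (x, y, t) + 2 * y $ j * partial_deriv (0, 0, 1) f (x, y, t))"

definition Y_field :: "'n::finite \<Rightarrow> ('n heis \<Rightarrow> real) \<Rightarrow> 'n heis \<Rightarrow> real" where
  "Y_field j f = (\<lambda>(x, y, t).
     partial_deriv (0, axis j 1, 0) f (x, y, t) - 2 * x $ j * partial_deriv (0, 0, 1) f (x, y, t))"

definition hgrad :: "('n::finite heis \<Rightarrow> real) \<Rightarrow> 'n heis \<Rightarrow> 'n hvec" where
  "hgrad f \<xi> = ((\<chi> j. X_field j f \<xi>), (\<chi> j. Y_field j f \<xi>))"

fun Ck :: "nat \<Rightarrow> ('a::euclidean_space \<Rightarrow> real) \<Rightarrow> bool" where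
  "Ck 0 f \<longleftrightarrow> continuous_on UNIV f"
| "Ck (Suc k) f \<longleftrightarrow> f differentiable_on UNIV \<and> (\<forall>b\<in>Basis. Ck k (partial_deriv b f))"

text \<open>
  Functions in \<open>C\<^sub>0\<^sup>k(\<Omega>)\<close> are taken to be extended by zero to the whole space.
\<close>

definition compact_support_in :: "'a::euclidean_space set \<Rightarrow> ('a \<Rightarrow> real) \<Rightarrow> bool" where
  "compact_support_in \<Omega> f \<longleftrightarrow> compact (closure {\<xi>. f \<xi> \<noteq> 0}) \<and> closure {\<xi>. f \<xi> \<noteq> 0} \<subseteq> \<Omega>"

definition C01 :: "'a::euclidean_space set \<Rightarrow> ('a \<Rightarrow> real) set" where
  "C01 \<Omega> = {f. Ck 1 f \<and> compact_support_in \<Omega> f}"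

definition C0inf :: "'a::euclidean_space set \<Rightarrow> ('a \<Rightarrow> real) set" where
  "C0inf \<Omega> = {f. (\<forall>k. Ck k f) \<and> compact_support_in \<Omega> f}"

text \<open>
  \<open>S0_grad p \<Omega> u G\<close>: the function \<open>u\<close> belongs to the completion of \<open>C\<^sub>0\<^sup>1(\<Omega>)\<close> in the norm
  \<open>(\<integral>\<^sub>\<Omega> |\<nabla>\<^sub>H u|\<^sup>p)\<^bsup>1/p\<^esup>\<close>, and \<open>G\<close> is its horizontal gradient there.  An element of the completion is a
  sequence in \<open>C\<^sub>0\<^sup>1(\<Omega>)\<close> whose gradients converge in \<open>L\<^sup>p(\<Omega>)\<close>; it is realised as the function \<open>u\<close> to
  which the sequence converges in \<open>L\<^sup>p\<close> on compact subsets of \<open>\<Omega>\<close>.  By integration by parts \<open>G\<close> is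
  then the distributional horizontal gradient of \<open>u\<close>, so it is unique up to null sets.
  Only the values of \<open>u\<close> and \<open>G\<close> on \<open>\<Omega>\<close> matter.
\<close>

definition S0_grad ::
  "real \<Rightarrow> 'n::finite heis set \<Rightarrow> ('n heis \<Rightarrow> real) \<Rightarrow> ('n heis \<Rightarrow> 'n hvec) \<Rightarrow> bool" where
  "S0_grad p \<Omega> u G \<longleftrightarrow>
     u \<in> borel_measurable (lebesgue_on \<Omega>) \<and> G \<in> borel_measurable (lebesgue_on \<Omega>) \<and>
     (\<exists>f :: nat \<Rightarrow> 'n heis \<Rightarrow> real.
        (\<forall>k. f k \<in> C01 \<Omega>) \<and>
        (\<lambda>k. \<integral>\<^sup>+ \<xi>. ennreal (norm (hgrad (f k) \<xi> - G \<xi>) powr p) \<partial>lebesgue_on \<Omega>) \<longlonglongrightarrow> 0 \<and>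
        (\<forall>K. compact K \<and> K \<subseteq> \<Omega> \<longrightarrow>
           (\<lambda>k. \<integral>\<^sup>+ \<xi>. ennreal (\<bar>f k \<xi> - u \<xi>\<bar> powr p) \<partial>lebesgue_on K) \<longlonglongrightarrow> 0))"

text \<open>
  The sub-solution inequality is required of every nonnegative \<open>\<phi>\<close> in the space for which its terms
  make sense.  The first integral always converges, by Hoelder's inequality.  The second need not
  (e.g. if \<open>\<Omega>\<close> is unbounded), and its Bochner integral would then be the meaningless value \<open>0\<close>;
  hence the integrability condition, which is void when \<open>lam = 0\<close>.
\<close>

definition subsolution ::
  "real \<Rightarrow> real \<Rightarrow> 'n::finite heis set \<Rightarrow> ('n heis \<Rightarrow> real) \<Rightarrow> ('n heis \<Rightarrow> 'n hvec) \<Rightarrow> bool" where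
  "subsolution p lam \<Omega> u Du \<longleftrightarrow>
     S0_grad p \<Omega> u Du \<and>
     (\<forall>\<phi> D\<phi>. S0_grad p \<Omega> \<phi> D\<phi> \<and> (AE \<xi> in lebesgue_on \<Omega>. 0 \<le> \<phi> \<xi>) \<and>
        (lam \<noteq> 0 \<longrightarrow> integrable (lebesgue_on \<Omega>) (\<lambda>\<xi>. \<bar>u \<xi>\<bar> powr (p - 2) * u \<xi> * \<phi> \<xi>)) \<longrightarrow>
        (\<integral>\<xi>. norm (Du \<xi>) powr (p - 2) * (Du \<xi> \<bullet> D\<phi> \<xi>) \<partial>lebesgue_on \<Omega>)
          - lam * (\<integral>\<xi>. \<bar>u \<xi>\<bar> powr (p - 2) * u \<xi> * \<phi> \<xi> \<partial>lebesgue_on \<Omega>) \<le> 0)"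

text \<open>
  Integral of a nonnegative function, with value \<open>\<infinity>\<close> allowed.  Should a
  right-hand side take the form \<open>\<infinity> - \<infinity>\<close>, \<open>ereal\<close> gives it the value \<open>\<infinity>\<close>: nothing is claimed then.
\<close>

definition ext_integral :: "'n::finite heis set \<Rightarrow> ('n heis \<Rightarrow> real) \<Rightarrow> ereal" where
  "ext_integral \<Omega> f = enn2ereal (\<integral>\<^sup>+ \<xi>. ennreal (f \<xi>) \<partial>lebesgue_on \<Omega>)"

end

theory Submission
  imports Defs
begin

text \<open>
  Put \<open>s = q - p + 1 > 0\<close>.  Formally one tests the sub-solution inequality with \<open>v\<^sup>s \<phi>\<^sup>p\<close>; Young's
  inequality absorbs the mixed term into the fraction \<open>(p-1)/p\<close> of the gradient term, with weights chosen so that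
  exactly the constant \<open>(p/s)\<^sup>p\<close> appears.  Since \<open>v\<^sup>s \<phi>\<^sup>p\<close> need not lie in the completion, \<open>v\<^sup>s\<close> is
  replaced by \<open>g(v)\<close> with \<open>g\<close> of class \<open>C\<^sup>1\<close> and \<open>g'\<close> bounded.  Young's inequality then produces
  \<open>g\<^sup>p (g')\<^bsup>1-p\<^esup> |\<nabla>\<phi>|\<^sup>p\<close>, which is dominated by \<open>(v\<^sup>q + (1 + v)\<^sup>p) |\<nabla>\<phi>|\<^sup>p\<close> uniformly in the approximation.  Fatou's
  lemma on the left and dominated convergence on the right give the limit; the negative part
  of \<open>\<lambda>\<close> is kept on the left, so that no difference of infinities arises.
\<close>

section \<open>Calculus of the horizontal gradient\<close>

text \<open>Two demands on \<open>g\<close> pull against each other. A bounded \<open>g'\<close>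
  puts the test function into the completion and makes the gradient term integrable, so that
  absorption is a subtraction of finite integrals. Absorption, however, leaves the negative power
  \<open>g' powr (1 - p)\<close>, so \<open>g'\<close> must stay positive on the positive axis. The
  condition \<open>g x \<le> c * ((1 + x) * g' x)\<close> reconciles both:
  \<open>g powr p * g' powr (1 - p)\<close> is then at most
  \<open>c powr p * (1 + x) powr p * g'\<close>, and this is integrable on the support of \<phi>
  because \<open>v\<close> is locally in \<open>L^p\<close>. Local \<open>L^p\<close> is all that is
  known of \<open>v\<close> at first; the power \<open>v powr q\<close> enters only in the limit.
  The constant arises as follows. The derivative of \<open>\<phi> powr p\<close> brings a factor
  \<open>p\<close>, and Young's inequality turns it into \<open>p powr (p - 1)\<close>. With
  \<open>g = x powr s\<close> and \<open>g' = s * x powr (s - 1)\<close> the remainder is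
  \<open>s powr (1 - p) * x powr (p - 1 + s)\<close>, where \<open>p - 1 + s = q\<close>. Division
  by \<open>s / p\<close>, the coefficient left on the gradient term, gives
  \<open>(p / s) powr p\<close>.\<close>

lemma Ck_1_iff:
  "Ck 1 f \<longleftrightarrow> f differentiable_on UNIV \<and> (\<forall>b\<in>Basis. continuous_on UNIV (partial_deriv b f))"
  by simp

lemma Ck_1_differentiable: "Ck 1 f \<Longrightarrow> f differentiable (at \<xi>)"
  by (simp add: Ck_1_iff differentiable_on_def)

lemma Ck_1_continuous_on: "Ck 1 f \<Longrightarrow> continuous_on S f"
  by (meson Ck_1_iff continuous_on_subset differentiable_imp_continuous_on subset_UNIV)

lemma partial_deriv_mult:
  assumes "f differentiable (at \<xi>)" "g differentiable (at \<xi>)"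
  shows "partial_deriv b (\<lambda>\<xi>. f \<xi> * g \<xi>) \<xi> = f \<xi> * partial_deriv b g \<xi> + partial_deriv b f \<xi> * g \<xi>"
proof -
  have "((\<lambda>\<xi>. f \<xi> * g \<xi>) has_derivative
      (\<lambda>h. f \<xi> * frechet_derivative g (at \<xi>) h + frechet_derivative f (at \<xi>) h * g \<xi>)) (at \<xi>)"
    using assms unfolding frechet_derivative_works by (rule has_derivative_mult)
  from frechet_derivative_at[OF this] show ?thesis
    by (simp add: partial_deriv_def fun_eq_iff)
qed

lemma differentiable_comp_real:
  fixes g :: "real \<Rightarrow> real"
  assumes "f differentiable (at \<xi>)" "(g has_real_derivative d) (at (f \<xi>))"
  shows "(\<lambda>\<xi>. g (f \<xi>)) differentiable (at \<xi>)"
  using differentiable_chain_at[of f \<xi> g] assms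
  by (auto simp: o_def real_differentiable_def)

lemma partial_deriv_comp:
  assumes "f differentiable (at \<xi>)" "(g has_real_derivative d) (at (f \<xi>))"
  shows "partial_deriv b (\<lambda>\<xi>. g (f \<xi>)) \<xi> = d * partial_deriv b f \<xi>"
proof -
  have "(f has_derivative frechet_derivative f (at \<xi>)) (at \<xi>)"
    using assms(1) by (simp add: frechet_derivative_works)
  then have "((\<lambda>\<xi>. g (f \<xi>)) has_derivative (\<lambda>h. d * frechet_derivative f (at \<xi>) h)) (at \<xi>)"
    using diff_chain_at[of f _ \<xi> g "(*) d"] assms(2)
    by (simp add: o_def has_field_derivative_def)
  from frechet_derivative_at[OF this] show ?thesis
    by (simp add: partial_deriv_def fun_eq_iff)
qed

lemma hgrad_mult:
  assumes "f differentiable (at \<xi>)" "g differentiable (at \<xi>)"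
  shows "hgrad (\<lambda>\<xi>. f \<xi> * g \<xi>) \<xi> = f \<xi> *\<^sub>R hgrad g \<xi> + g \<xi> *\<^sub>R hgrad f \<xi>"
  by (cases \<xi>)
     (use assms in \<open>simp add: hgrad_def X_field_def Y_field_def partial_deriv_mult vec_eq_iff algebra_simps\<close>)

lemma hgrad_comp:
  assumes "f differentiable (at \<xi>)" "(g has_real_derivative d) (at (f \<xi>))"
  shows "hgrad (\<lambda>\<xi>. g (f \<xi>)) \<xi> = d *\<^sub>R hgrad f \<xi>"
  by (cases \<xi>)
     (use assms in \<open>simp add: hgrad_def X_field_def Y_field_def partial_deriv_comp vec_eq_iff algebra_simps\<close>)

lemma Ck_1_mult:
  assumes "Ck 1 f" "Ck 1 g"
  shows "Ck 1 (\<lambda>\<xi>. f \<xi> * g \<xi>)"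
proof -
  have "partial_deriv b (\<lambda>\<xi>. f \<xi> * g \<xi>) = (\<lambda>\<xi>. f \<xi> * partial_deriv b g \<xi> + partial_deriv b f \<xi> * g \<xi>)" for b
    using assms by (auto simp: partial_deriv_mult Ck_1_differentiable)
  moreover have "(\<lambda>\<xi>. f \<xi> * g \<xi>) differentiable_on UNIV"
    using assms by (simp add: Ck_1_iff)
  ultimately show ?thesis
    using assms Ck_1_continuous_on[of f UNIV] Ck_1_continuous_on[of g UNIV]
    by (simp add: Ck_1_iff continuous_on_add continuous_on_mult)
qed

lemma Ck_1_comp:
  assumes "Ck 1 f" and g: "\<And>x. (g has_real_derivative g' x) (at x)" "continuous_on UNIV g'"
  shows "Ck 1 (\<lambda>\<xi>. g (f \<xi>))"
proof -
  have "partial_deriv b (\<lambda>\<xi>. g (f \<xi>)) = (\<lambda>\<xi>. g' (f \<xi>) * partial_deriv b f \<xi>)" for b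
    using assms by (auto simp: partial_deriv_comp[where d = "g' _"] Ck_1_differentiable)
  moreover have "(\<lambda>\<xi>. g (f \<xi>)) differentiable_on UNIV"
    using differentiable_comp_real[OF Ck_1_differentiable[OF assms(1)] g(1)]
    by (simp add: differentiable_on_def)
  moreover have "continuous_on UNIV (\<lambda>\<xi>. g' (f \<xi>))"
    by (rule continuous_on_compose2[OF g(2) Ck_1_continuous_on[OF assms(1)]]) auto
  ultimately show ?thesis
    using assms(1) by (simp add: Ck_1_iff continuous_on_mult)
qed

lemma continuous_on_hgrad:
  fixes f :: "'n::finite heis \<Rightarrow> real"
  assumes "Ck 1 f"
  shows "continuous_on S (hgrad f)"
proof -
  have c: "continuous_on UNIV (partial_deriv b f)" if "b \<in> Basis" for b
    using assms that by (simp add: Ck_1_iff)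
  have "continuous_on UNIV (partial_deriv (axis j 1, 0, 0) f)"
       "continuous_on UNIV (partial_deriv (0, axis j 1, 0) f)"
       "continuous_on UNIV (partial_deriv (0, 0, 1) f)" for j :: 'n
    by (rule c; simp add: Basis_prod_def image_iff zero_prod_def)+
  then have "continuous_on UNIV (hgrad f)"
    unfolding hgrad_def X_field_def Y_field_def
    by (auto simp: split_beta intro!: continuous_intros continuous_on_vec_lambda)
  then show ?thesis
    by (rule continuous_on_subset) auto
qed

text \<open>Off the closed support \<open>f\<close> vanishes on a whole neighbourhood, so its
  derivative there is zero whatever its regularity elsewhere.\<close>

lemma hgrad_eq_0:
  assumes "\<xi> \<notin> closure {\<xi>. f \<xi> \<noteq> 0}"
  shows "hgrad f \<xi> = 0"
proof -
  have "eventually (\<lambda>x. x \<in> - closure {\<xi>. f \<xi> \<noteq> 0}) (nhds \<xi>)"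
    using assms by (intro eventually_nhds_in_open) auto
  then have "eventually (\<lambda>x. f x = 0) (nhds \<xi>)"
    by (rule eventually_mono) (use closure_subset[of "{\<xi>. f \<xi> \<noteq> 0}"] in blast)
  then have "(f has_derivative (\<lambda>_. 0)) (at \<xi>)"
    by (intro has_derivative_transform_eventually[OF has_derivative_const[of 0]])
       (auto simp: eventually_nhds_conv_at elim: eventually_mono)
  from frechet_derivative_at[OF this] have "frechet_derivative f (at \<xi>) = (\<lambda>_. 0)"
    by simp
  then show ?thesis
    by (cases \<xi>) (simp add: hgrad_def X_field_def Y_field_def partial_deriv_def zero_prod_def vec_eq_iff)
qed

section \<open>Functions of class \<open>C^1\<close> with compact support\<close>

lemma compact_support_in_mono:
  assumes "compact_support_in \<Omega> f" "\<And>\<xi>. f \<xi> = 0 \<Longrightarrow> g \<xi> = 0"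
  shows "compact_support_in \<Omega> g"
proof -
  have *: "closure {\<xi>. g \<xi> \<noteq> 0} \<subseteq> closure {\<xi>. f \<xi> \<noteq> 0}"
    using assms(2) by (intro closure_mono) auto
  with assms(1) have "compact (closure {\<xi>. f \<xi> \<noteq> 0} \<inter> closure {\<xi>. g \<xi> \<noteq> 0})"
    by (intro compact_Int_closed) (auto simp: compact_support_in_def)
  with * assms(1) show ?thesis
    by (auto simp: compact_support_in_def Int_absorb1)
qed

lemma C01_mult_comp:
  assumes "Ck 1 f" "\<psi> \<in> C01 \<Omega>"
    and "\<And>x. (g has_real_derivative g' x) (at x)" "continuous_on UNIV g'"
  shows "(\<lambda>\<xi>. g (f \<xi>) * \<psi> \<xi>) \<in> C01 \<Omega>"
  using assms(2) Ck_1_mult[OF Ck_1_comp[OF assms(1,3,4)], of \<psi>]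
    compact_support_in_mono[of \<Omega> \<psi> "\<lambda>\<xi>. g (f \<xi>) * \<psi> \<xi>"]
  by (simp add: C01_def)

lemma C01_comp:
  assumes "f \<in> C01 \<Omega>" "g 0 = 0"
    and "\<And>x. (g has_real_derivative g' x) (at x)" "continuous_on UNIV g'"
  shows "(\<lambda>\<xi>. g (f \<xi>)) \<in> C01 \<Omega>"
  using assms(1,2) Ck_1_comp[OF _ assms(3,4), of f]
    compact_support_in_mono[of \<Omega> f "\<lambda>\<xi>. g (f \<xi>)"]
  by (simp add: C01_def)

text \<open>Integrals over the possibly unbounded domain are reduced to one compact set, and
  function and gradient share one bound. The closed support and the sum of the two separate bounds
  serve.\<close>

lemma C01_bounded:
  assumes "\<psi> \<in> C01 \<Omega>"
  obtains K M where "compact K" "K \<subseteq> \<Omega>" "M > 0"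
    "\<And>\<xi>. \<xi> \<notin> K \<Longrightarrow> \<psi> \<xi> = 0" "\<And>\<xi>. \<xi> \<notin> K \<Longrightarrow> hgrad \<psi> \<xi> = 0"
    "\<And>\<xi>. \<bar>\<psi> \<xi>\<bar> \<le> M" "\<And>\<xi>. norm (hgrad \<psi> \<xi>) \<le> M"
proof -
  define K where "K = closure {\<xi>. \<psi> \<xi> \<noteq> 0}"
  have K: "compact K" "K \<subseteq> \<Omega>" and C: "Ck 1 \<psi>"
    using assms by (auto simp: C01_def compact_support_in_def K_def)
  have 0: "\<psi> \<xi> = 0" "hgrad \<psi> \<xi> = 0" if "\<xi> \<notin> K" for \<xi>
    using that closure_subset[of "{\<xi>. \<psi> \<xi> \<noteq> 0}"] by (auto simp: K_def hgrad_eq_0)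
  have "compact (\<psi> ` K)" "compact (hgrad \<psi> ` K)"
    using K C by (auto intro!: compact_continuous_image Ck_1_continuous_on continuous_on_hgrad)
  then have "bounded (\<psi> ` K)" "bounded (hgrad \<psi> ` K)"
    using compact_imp_bounded by blast+
  then obtain A B where AB: "A > 0" "B > 0" "\<And>\<xi>. \<xi> \<in> K \<Longrightarrow> \<bar>\<psi> \<xi>\<bar> \<le> A" "\<And>\<xi>. \<xi> \<in> K \<Longrightarrow> norm (hgrad \<psi> \<xi>) \<le> B"
    by (auto simp: bounded_pos)
  show ?thesis
  proof (rule that[of K "A + B"])
    show "\<bar>\<psi> \<xi>\<bar> \<le> A + B" "norm (hgrad \<psi> \<xi>) \<le> A + B" for \<xi>
      using AB(1,2) AB(3,4)[of \<xi>] 0[of \<xi>] by (cases "\<xi> \<in> K"; simp)+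
  qed (use K AB 0 in auto)
qed

section \<open>Convergence in \<open>L\<^sup>p\<close>\<close>

text \<open>Convergence to zero in \<open>L^p\<close>, written with the nonnegative integral so that
  infinite terms are allowed, and with a general norm so that it covers functions and gradients
  alike. It restates both limits in \<open>S0_grad\<close>.\<close>

definition Lp_null :: "'a measure \<Rightarrow> real \<Rightarrow> (nat \<Rightarrow> 'a \<Rightarrow> 'b::real_normed_vector) \<Rightarrow> bool" where
  "Lp_null M p a \<longleftrightarrow> (\<lambda>k. \<integral>\<^sup>+x. ennreal (norm (a k x) powr p) \<partial>M) \<longlonglongrightarrow> 0"

lemma ennreal_tendsto_0_le:
  fixes f g :: "nat \<Rightarrow> ennreal"
  assumes "f \<longlonglongrightarrow> 0" "\<And>k. g k \<le> f k"
  shows "g \<longlonglongrightarrow> 0"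
  by (rule tendsto_sandwich[OF _ _ tendsto_const assms(1)]) (simp_all add: assms(2))

text \<open>The sum is at most twice the larger norm. The factor \<open>2 powr p\<close> is not
  sharp, but it comes without convexity, hence also for \<open>p < 1\<close>.\<close>

lemma powr_norm_add_le:
  fixes a b :: "'a::real_normed_vector"
  assumes "0 \<le> p"
  shows "norm (a + b) powr p \<le> 2 powr p * (norm a powr p + norm b powr p)"
proof -
  have "norm (a + b) powr p \<le> (2 * max (norm a) (norm b)) powr p"
    using norm_triangle_ineq[of a b] assms by (intro powr_mono2) auto
  also have "\<dots> = 2 powr p * max (norm a) (norm b) powr p"
    by (simp add: powr_mult)
  also have "\<dots> \<le> 2 powr p * (norm a powr p + norm b powr p)"
    by (intro mult_left_mono) (auto simp: max_def)
  finally show ?thesis .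
qed

lemma nn_integral_powr_norm_add_le:
  fixes a b :: "'a \<Rightarrow> 'b::{real_normed_vector, second_countable_topology}"
  assumes "0 \<le> p" and [measurable]: "a \<in> borel_measurable M" "b \<in> borel_measurable M"
  shows "(\<integral>\<^sup>+x. ennreal (norm (a x + b x) powr p) \<partial>M) \<le> ennreal (2 powr p) *
    ((\<integral>\<^sup>+x. ennreal (norm (a x) powr p) \<partial>M) + (\<integral>\<^sup>+x. ennreal (norm (b x) powr p) \<partial>M))"
proof -
  have "(\<integral>\<^sup>+x. ennreal (norm (a x + b x) powr p) \<partial>M) \<le>
    (\<integral>\<^sup>+x. ennreal (2 powr p) * (ennreal (norm (a x) powr p) + ennreal (norm (b x) powr p)) \<partial>M)"
    using powr_norm_add_le[OF assms(1)]
    by (intro nn_integral_mono) (simp flip: ennreal_plus ennreal_mult add: ennreal_leI)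
  then show ?thesis
    by (simp add: nn_integral_cmult nn_integral_add)
qed

lemma Lp_null_add:
  fixes a b :: "nat \<Rightarrow> 'a \<Rightarrow> 'b::{real_normed_vector, second_countable_topology}"
  assumes "0 \<le> p" "Lp_null M p a" "Lp_null M p b"
    and "\<And>k. a k \<in> borel_measurable M" "\<And>k. b k \<in> borel_measurable M"
  shows "Lp_null M p (\<lambda>k x. a k x + b k x)"
proof -
  let ?I = "\<lambda>c k. \<integral>\<^sup>+x. ennreal (norm (c k x) powr p) \<partial>M"
  have "(\<lambda>k. ennreal (2 powr p) * (?I a k + ?I b k)) \<longlonglongrightarrow> ennreal (2 powr p) * (0 + 0)"
    using assms(2,3) unfolding Lp_null_def by (intro ennreal_tendsto_cmult tendsto_add) auto
  then show ?thesis
    unfolding Lp_null_def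
    by (intro ennreal_tendsto_0_le[OF _ nn_integral_powr_norm_add_le[OF assms(1,4,5)]]) simp
qed

lemma Lp_null_bound:
  fixes a :: "nat \<Rightarrow> 'a \<Rightarrow> 'b::{real_normed_vector, second_countable_topology}"
    and b :: "nat \<Rightarrow> 'a \<Rightarrow> 'c::real_normed_vector"
  assumes "0 \<le> p" "Lp_null M p a" and [measurable]: "\<And>k. a k \<in> borel_measurable M"
    and le: "\<And>k. AE x in M. norm (b k x) \<le> C * norm (a k x)" and "0 \<le> C"
  shows "Lp_null M p b"
proof -
  let ?I = "\<lambda>k. \<integral>\<^sup>+x. ennreal (norm (a k x) powr p) \<partial>M"
  have *: "(\<integral>\<^sup>+x. ennreal (norm (b k x) powr p) \<partial>M) \<le> ennreal (C powr p) * ?I k" for k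
  proof -
    have "(\<integral>\<^sup>+x. ennreal (norm (b k x) powr p) \<partial>M) \<le>
        (\<integral>\<^sup>+x. ennreal (C powr p) * ennreal (norm (a k x) powr p) \<partial>M)"
    proof (rule nn_integral_mono_AE, use le[of k] in eventually_elim)
      case (elim x)
      then have "norm (b k x) powr p \<le> (C * norm (a k x)) powr p"
        using assms(1) by (intro powr_mono2) auto
      then show ?case
        using \<open>0 \<le> C\<close> by (subst ennreal_mult[symmetric]) (simp_all add: powr_mult ennreal_leI)
    qed
    then show ?thesis
      by (simp add: nn_integral_cmult)
  qed
  have "(\<lambda>k. ennreal (C powr p) * ?I k) \<longlonglongrightarrow> ennreal (C powr p) * 0"
    using assms(2) unfolding Lp_null_def by (intro ennreal_tendsto_cmult) auto
  then show ?thesis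
    unfolding Lp_null_def by (intro ennreal_tendsto_0_le[OF _ *]) simp
qed

lemma Lp_null_dominated:
  fixes a :: "nat \<Rightarrow> 'a \<Rightarrow> 'b::{real_normed_vector, second_countable_topology}"
    and w :: "'a \<Rightarrow> real"
  assumes "0 < p" and [measurable]: "\<And>k. a k \<in> borel_measurable M" "w \<in> borel_measurable M"
    and lim: "AE x in M. (\<lambda>k. a k x) \<longlonglongrightarrow> 0"
    and le: "\<And>k. AE x in M. norm (a k x) \<le> w x"
    and fin: "(\<integral>\<^sup>+x. ennreal (w x powr p) \<partial>M) < \<infinity>"
  shows "Lp_null M p a"
proof -
  have "(\<lambda>k. \<integral>\<^sup>+x. ennreal (norm (a k x) powr p) \<partial>M) \<longlonglongrightarrow> (\<integral>\<^sup>+x. 0 \<partial>M)"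
  proof (rule nn_integral_dominated_convergence[where w = "\<lambda>x. ennreal (w x powr p)"])
    show "AE x in M. ennreal (norm (a k x) powr p) \<le> ennreal (w x powr p)" for k
      using le[of k] by eventually_elim (use assms(1) in \<open>auto intro!: ennreal_leI powr_mono2\<close>)
    show "AE x in M. (\<lambda>k. ennreal (norm (a k x) powr p)) \<longlonglongrightarrow> 0"
      using lim
    proof eventually_elim
      case (elim x)
      then have "(\<lambda>k. norm (a k x) powr p) \<longlonglongrightarrow> 0"
        using assms(1) by (intro tendsto_zero_powrI[OF _ tendsto_const]) (auto intro: tendsto_norm_zero)
      from tendsto_ennrealI[OF this] show ?case
        by simp
    qed
  qed (use fin in auto)
  then show ?thesis
    by (simp add: Lp_null_def)
qed

lemma Lp_null_subseq:
  assumes "Lp_null M p a" "strict_mono r"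
  shows "Lp_null M p (\<lambda>k. a (r k))"
  using LIMSEQ_subseq_LIMSEQ[OF assms(1)[unfolded Lp_null_def] assms(2)]
  by (simp add: Lp_null_def o_def)

text \<open>The \<open>p\<close>-th powers of the norms tend to zero in \<open>L^1\<close>, which
  gives an almost everywhere convergent subsequence; the power \<open>1 / p\<close> then undoes the
  \<open>p\<close>-th power.\<close>

lemma Lp_null_AE_subseq:
  fixes a :: "nat \<Rightarrow> 'a \<Rightarrow> 'b::{real_normed_vector, second_countable_topology}"
  assumes "0 < p" "Lp_null M p a" and [measurable]: "\<And>k. a k \<in> borel_measurable M"
  obtains r :: "nat \<Rightarrow> nat" where "strict_mono r" "AE x in M. (\<lambda>k. a (r k) x) \<longlonglongrightarrow> 0"
proof -
  let ?I = "\<lambda>k. \<integral>\<^sup>+x. ennreal (norm (a k x) powr p) \<partial>M"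
  have I: "?I \<longlonglongrightarrow> 0"
    using assms(2) by (simp add: Lp_null_def)
  then have "eventually (\<lambda>k. ?I k < 1) sequentially"
    by (rule order_tendstoD) simp
  \<comment> \<open>The first few integrals may be infinite, while the \<open>L^1\<close> result
    needs every term integrable; the sequence is therefore started at \<open>N\<close>.\<close>
  then obtain N where N: "\<And>k. k \<ge> N \<Longrightarrow> ?I k < 1"
    by (auto simp: eventually_sequentially)
  have fin: "?I (k + N) < \<infinity>" for k
    using N[of "k + N"] by (auto intro: less_trans)
  have "integrable M (\<lambda>x. norm (a (k + N) x) powr p)" for k
    by (rule integrableI_nonneg) (use fin[of k] in auto)
  moreover have "(\<lambda>k. \<integral>x. norm (norm (a (k + N) x) powr p) \<partial>M) \<longlonglongrightarrow> 0"
  proof -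
    have "(\<lambda>k. enn2real (?I (k + N))) \<longlonglongrightarrow> 0"
      by (rule tendsto_enn2real) (use LIMSEQ_ignore_initial_segment[OF I, of N] in auto)
    then show ?thesis
      by (simp add: integral_eq_nn_integral)
  qed
  ultimately obtain r :: "nat \<Rightarrow> nat" where r: "strict_mono r"
      "AE x in M. (\<lambda>k. norm (a (r k + N) x) powr p) \<longlonglongrightarrow> 0"
    using tendsto_L1_AE_subseq[of M "\<lambda>k x. norm (a (k + N) x) powr p"] by auto
  show ?thesis
  proof (rule that[of "\<lambda>k. r k + N"])
    show "AE x in M. (\<lambda>k. a (r k + N) x) \<longlonglongrightarrow> 0"
      using r(2)
    proof eventually_elim
      case (elim x)
      have "(\<lambda>k. (norm (a (r k + N) x) powr p) powr (1 / p)) \<longlonglongrightarrow> 0"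
        by (rule tendsto_zero_powrI[OF elim tendsto_const]) (use assms(1) in auto)
      then have "(\<lambda>k. norm (a (r k + N) x)) \<longlonglongrightarrow> 0"
        using assms(1) by (simp add: powr_powr)
      then show ?case
        by (rule tendsto_norm_zero_cancel)
    qed
  qed (use r(1) in \<open>auto simp: strict_mono_def\<close>)
qed

text \<open>Some \<open>f k\<close> differs from \<open>u\<close> by an integral below 1, and the
  integral of \<open>f k\<close> itself is finite.\<close>

lemma Lp_finite_of_null:
  fixes u :: "'a \<Rightarrow> 'b::{real_normed_vector, second_countable_topology}"
  assumes "0 \<le> p" "Lp_null M p (\<lambda>k x. f k x - u x)"
    and [measurable]: "\<And>k. f k \<in> borel_measurable M" "u \<in> borel_measurable M"
    and fin: "\<And>k. (\<integral>\<^sup>+x. ennreal (norm (f k x) powr p) \<partial>M) < \<infinity>"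
  shows "(\<integral>\<^sup>+x. ennreal (norm (u x) powr p) \<partial>M) < \<infinity>"
proof -
  have "eventually (\<lambda>k. (\<integral>\<^sup>+x. ennreal (norm (f k x - u x) powr p) \<partial>M) < 1) sequentially"
    using assms(2) unfolding Lp_null_def by (rule order_tendstoD) simp
  then obtain k where k: "(\<integral>\<^sup>+x. ennreal (norm (f k x - u x) powr p) \<partial>M) < 1"
    by (auto simp: eventually_sequentially)
  have "(\<integral>\<^sup>+x. ennreal (norm (u x) powr p) \<partial>M) =
      (\<integral>\<^sup>+x. ennreal (norm ((u x - f k x) + f k x) powr p) \<partial>M)"
    by simp
  also have "\<dots> \<le> ennreal (2 powr p) * ((\<integral>\<^sup>+x. ennreal (norm (u x - f k x) powr p) \<partial>M) +
      (\<integral>\<^sup>+x. ennreal (norm (f k x) powr p) \<partial>M))"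
    by (rule nn_integral_powr_norm_add_le) (use assms(1) in auto)
  also have "\<dots> < \<infinity>"
    using less_trans[OF k, of \<infinity>] fin[of k]
    by (simp add: norm_minus_commute ennreal_mult_less_top)
  finally show ?thesis .
qed

section \<open>Integrals over subsets of the domain\<close>

lemma nn_integral_lebesgue_on_support:
  assumes "K \<in> sets lebesgue" "S \<in> sets lebesgue" "K \<subseteq> S" "\<And>x. x \<in> S - K \<Longrightarrow> F x = 0"
  shows "(\<integral>\<^sup>+x. F x \<partial>lebesgue_on S) = (\<integral>\<^sup>+x. F x \<partial>lebesgue_on K)"
  using assms
  by (auto simp: nn_integral_restrict_space indicator_def intro!: nn_integral_cong)

lemma nn_integral_lebesgue_on_mono:
  assumes "K \<in> sets lebesgue" "S \<in> sets lebesgue" "K \<subseteq> S"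
  shows "(\<integral>\<^sup>+x. F x \<partial>lebesgue_on K) \<le> (\<integral>\<^sup>+x. F x \<partial>lebesgue_on S)"
  using assms
  by (auto simp: nn_integral_restrict_space indicator_def intro!: nn_integral_mono)

lemma nn_integral_lebesgue_on_bounded_finite:
  fixes F :: "'a::euclidean_space \<Rightarrow> real"
  assumes "compact K" "\<And>x. x \<in> K \<Longrightarrow> F x \<le> B"
  shows "(\<integral>\<^sup>+x. ennreal (F x) \<partial>lebesgue_on K) < \<infinity>"
proof -
  have K: "K \<in> sets lebesgue"
    using lmeasurable_compact[OF assms(1)] by auto
  have "(\<integral>\<^sup>+x. ennreal (F x) \<partial>lebesgue_on K) \<le> (\<integral>\<^sup>+x. ennreal B \<partial>lebesgue_on K)"
    using assms(2) K by (intro nn_integral_mono) (auto intro: ennreal_leI)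
  also have "\<dots> = ennreal B * emeasure lebesgue K"
    using K by (simp add: emeasure_restrict_space)
  also have "\<dots> < \<infinity>"
    using lmeasurable_compact[OF assms(1)] by (auto simp: ennreal_mult_less_top fmeasurable_def)
  finally show ?thesis .
qed

section \<open>Chain rule in the completion\<close>

lemma Lipschitz_of_deriv_bound:
  fixes g :: "real \<Rightarrow> real"
  assumes "\<And>x. (g has_real_derivative g' x) (at x)" "\<And>x. \<bar>g' x\<bar> \<le> L"
  shows "\<bar>g x - g y\<bar> \<le> L * \<bar>x - y\<bar>"
  using field_differentiable_bound[of UNIV g g' L x y] assms by auto

lemma S0_grad_iff_Lp_null:
  "S0_grad p \<Omega> u G \<longleftrightarrow>
    u \<in> borel_measurable (lebesgue_on \<Omega>) \<and> G \<in> borel_measurable (lebesgue_on \<Omega>) \<and>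
    (\<exists>f. (\<forall>k. f k \<in> C01 \<Omega>) \<and> Lp_null (lebesgue_on \<Omega>) p (\<lambda>k \<xi>. hgrad (f k) \<xi> - G \<xi>) \<and>
      (\<forall>K. compact K \<and> K \<subseteq> \<Omega> \<longrightarrow> Lp_null (lebesgue_on K) p (\<lambda>k \<xi>. f k \<xi> - u \<xi>)))"
  by (simp add: S0_grad_def Lp_null_def)

lemma S0_grad_approx:
  assumes "S0_grad p \<Omega> u G"
  shows "\<exists>f. (\<forall>k. f k \<in> C01 \<Omega>) \<and> Lp_null (lebesgue_on \<Omega>) p (\<lambda>k \<xi>. hgrad (f k) \<xi> - G \<xi>) \<and>
      (\<forall>K. compact K \<and> K \<subseteq> \<Omega> \<longrightarrow> Lp_null (lebesgue_on K) p (\<lambda>k \<xi>. f k \<xi> - u \<xi>))"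
    "u \<in> borel_measurable (lebesgue_on \<Omega>)" "G \<in> borel_measurable (lebesgue_on \<Omega>)"
  using assms by (auto simp: S0_grad_iff_Lp_null)

lemma C01_measurable:
  fixes f :: "'n::finite heis \<Rightarrow> real"
  assumes "f \<in> C01 \<Omega>" "S \<in> sets lebesgue"
  shows "f \<in> borel_measurable (lebesgue_on S)" "hgrad f \<in> borel_measurable (lebesgue_on S)"
  using assms
  by (auto simp: C01_def intro!: continuous_imp_measurable_on_sets_lebesgue Ck_1_continuous_on continuous_on_hgrad)

text \<open>The approximating gradients are bounded with compact support, hence in
  \<open>L^p\<close>, and the limit inherits this.\<close>

lemma S0_grad_Lp:
  assumes "open \<Omega>" "0 < p" "S0_grad p \<Omega> u G"
  shows "(\<integral>\<^sup>+\<xi>. ennreal (norm (G \<xi>) powr p) \<partial>lebesgue_on \<Omega>) < \<infinity>"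
proof -
  have O: "\<Omega> \<in> sets lebesgue"
    using assms(1) by auto
  note u = S0_grad_approx(2)[OF assms(3)] and G = S0_grad_approx(3)[OF assms(3)]
  obtain f where f: "\<forall>k. f k \<in> C01 \<Omega>" "Lp_null (lebesgue_on \<Omega>) p (\<lambda>k \<xi>. hgrad (f k) \<xi> - G \<xi>)"
      "\<forall>K. compact K \<and> K \<subseteq> \<Omega> \<longrightarrow> Lp_null (lebesgue_on K) p (\<lambda>k \<xi>. f k \<xi> - u \<xi>)"
    using S0_grad_approx(1)[OF assms(3)] by blast
  have "(\<integral>\<^sup>+\<xi>. ennreal (norm (hgrad (f k) \<xi>) powr p) \<partial>lebesgue_on \<Omega>) < \<infinity>" for k
  proof -
    obtain K M where K: "compact K" "K \<subseteq> \<Omega>" "M > 0" "\<And>\<xi>. \<xi> \<notin> K \<Longrightarrow> f k \<xi> = 0"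
        "\<And>\<xi>. \<xi> \<notin> K \<Longrightarrow> hgrad (f k) \<xi> = 0" "\<And>\<xi>. \<bar>f k \<xi>\<bar> \<le> M" "\<And>\<xi>. norm (hgrad (f k) \<xi>) \<le> M"
      using C01_bounded[OF spec[OF f(1), of k]] by blast
    have "(\<integral>\<^sup>+\<xi>. ennreal (norm (hgrad (f k) \<xi>) powr p) \<partial>lebesgue_on \<Omega>) =
        (\<integral>\<^sup>+\<xi>. ennreal (norm (hgrad (f k) \<xi>) powr p) \<partial>lebesgue_on K)"
      using K O lmeasurable_compact[OF K(1)] assms(2)
      by (intro nn_integral_lebesgue_on_support) auto
    also have "\<dots> < \<infinity>"
      using K assms(2)
      by (intro nn_integral_lebesgue_on_bounded_finite[where B = "M powr p"] powr_mono2) auto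
    finally show ?thesis .
  qed
  then show ?thesis
    by (intro Lp_finite_of_null[OF _ f(2) C01_measurable(2)[OF spec[OF f(1)] O] G])
       (use assms(2) in simp_all)
qed

text \<open>The approximants converge to \<open>u\<close> only on compact sets, so integrability of
  \<open>u\<close> itself is local. This suffices for test functions that carry a compactly
  supported factor.\<close>

lemma S0_grad_local_Lp:
  assumes "open \<Omega>" "0 < p" "S0_grad p \<Omega> u G" "compact K" "K \<subseteq> \<Omega>"
  shows "(\<integral>\<^sup>+\<xi>. ennreal (\<bar>u \<xi>\<bar> powr p) \<partial>lebesgue_on K) < \<infinity>"
proof -
  have Kl: "K \<in> sets lebesgue"
    using lmeasurable_compact[OF assms(4)] by auto
  note u = S0_grad_approx(2)[OF assms(3)] and G = S0_grad_approx(3)[OF assms(3)]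
  obtain f where f: "\<forall>k. f k \<in> C01 \<Omega>" "Lp_null (lebesgue_on \<Omega>) p (\<lambda>k \<xi>. hgrad (f k) \<xi> - G \<xi>)"
      "\<forall>K. compact K \<and> K \<subseteq> \<Omega> \<longrightarrow> Lp_null (lebesgue_on K) p (\<lambda>k \<xi>. f k \<xi> - u \<xi>)"
    using S0_grad_approx(1)[OF assms(3)] by blast
  have "(\<integral>\<^sup>+\<xi>. ennreal (norm (f k \<xi>) powr p) \<partial>lebesgue_on K) < \<infinity>" for k
  proof -
    obtain K' M where K: "compact K'" "K' \<subseteq> \<Omega>" "M > 0" "\<And>\<xi>. \<xi> \<notin> K' \<Longrightarrow> f k \<xi> = 0"
        "\<And>\<xi>. \<xi> \<notin> K' \<Longrightarrow> hgrad (f k) \<xi> = 0" "\<And>\<xi>. \<bar>f k \<xi>\<bar> \<le> M" "\<And>\<xi>. norm (hgrad (f k) \<xi>) \<le> M"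
      using C01_bounded[OF spec[OF f(1), of k]] by blast
    then show ?thesis using assms(2,4)
      by (intro nn_integral_lebesgue_on_bounded_finite[where B = "M powr p"] powr_mono2) auto
  qed
  then have "(\<integral>\<^sup>+\<xi>. ennreal (norm (u \<xi>) powr p) \<partial>lebesgue_on K) < \<infinity>"
    by (intro Lp_finite_of_null[OF _ f(3)[rule_format, OF conjI[OF assms(4,5)]]
          C01_measurable(1)[OF spec[OF f(1)] Kl] measurable_restrict_mono[OF u assms(5)]])
       (use assms(2) in simp_all)
  then show ?thesis
    by simp
qed

lemma AE_lebesgue_on_support:
  assumes "K \<in> sets lebesgue" "S \<in> sets lebesgue" "AE x in lebesgue_on K. P x" 
  shows "AE x in lebesgue_on S. x \<in> K \<longrightarrow> P x"
proof -
  have "AE x in lebesgue. x \<in> K \<longrightarrow> P x"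
    using assms(1,3) by (simp add: AE_restrict_space_iff)
  then have "AE x in lebesgue. x \<in> S \<longrightarrow> x \<in> K \<longrightarrow> P x"
    by eventually_elim auto
  then show ?thesis
    using assms(2) by (simp add: AE_restrict_space_iff)
qed

text \<open>
  Multiplying by \<open>g'(f\<^sub>k)\<close> only preserves \<open>L\<^sup>p\<close> convergence of the gradients if \<open>g'(f\<^sub>k)\<close> converges
  almost everywhere, whence the passage to a subsequence.
\<close>

lemma S0_grad_comp_mult:
  assumes "open \<Omega>" "0 < p" "S0_grad p \<Omega> u G" "\<psi> \<in> C01 \<Omega>"
    and g: "\<And>x. (g has_real_derivative g' x) (at x)" "continuous_on UNIV g'" "\<And>x. \<bar>g' x\<bar> \<le> L"
  shows "S0_grad p \<Omega> (\<lambda>\<xi>. g (u \<xi>) * \<psi> \<xi>) (\<lambda>\<xi>. (g' (u \<xi>) * \<psi> \<xi>) *\<^sub>R G \<xi> + g (u \<xi>) *\<^sub>R hgrad \<psi> \<xi>)"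
proof -
  have O: "\<Omega> \<in> sets lebesgue"
    using assms(1) by auto
  have "0 \<le> L"
    using g(3)[of 0] by linarith
  note u [measurable] = S0_grad_approx(2)[OF assms(3)] and G [measurable] = S0_grad_approx(3)[OF assms(3)]
  obtain f0 where f0: "\<forall>k. f0 k \<in> C01 \<Omega>" "Lp_null (lebesgue_on \<Omega>) p (\<lambda>k \<xi>. hgrad (f0 k) \<xi> - G \<xi>)"
      "\<forall>K. compact K \<and> K \<subseteq> \<Omega> \<longrightarrow> Lp_null (lebesgue_on K) p (\<lambda>k \<xi>. f0 k \<xi> - u \<xi>)"
    using S0_grad_approx(1)[OF assms(3)] by blast
  obtain K M where K: "compact K" "K \<subseteq> \<Omega>" "M > 0"
      and \<psi>0: "\<And>\<xi>. \<xi> \<notin> K \<Longrightarrow> \<psi> \<xi> = 0" "\<And>\<xi>. \<xi> \<notin> K \<Longrightarrow> hgrad \<psi> \<xi> = 0"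
      and \<psi>M: "\<And>\<xi>. \<bar>\<psi> \<xi>\<bar> \<le> M" "\<And>\<xi>. norm (hgrad \<psi> \<xi>) \<le> M"
    using C01_bounded[OF assms(4)] by blast
  have Kl: "K \<in> sets lebesgue"
    using lmeasurable_compact[OF K(1)] by auto
  have \<psi>m [measurable]: "\<psi> \<in> borel_measurable (lebesgue_on \<Omega>)" "hgrad \<psi> \<in> borel_measurable (lebesgue_on \<Omega>)"
    using C01_measurable[OF assms(4) O] by auto
  have uK: "u \<in> borel_measurable (lebesgue_on K)"
    by (rule measurable_restrict_mono[OF u K(2)])
  \<comment> \<open>A single compact set serves: off \<open>K\<close> both \<open>\<psi>\<close> and
    its gradient vanish, so the behaviour of the subsequence there does not enter.\<close>
  obtain r :: "nat \<Rightarrow> nat" where r: "strict_mono r"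
      and lim: "AE \<xi> in lebesgue_on K. (\<lambda>k. f0 (r k) \<xi> - u \<xi>) \<longlonglongrightarrow> 0"
    by (rule Lp_null_AE_subseq[OF assms(2) f0(3)[rule_format, OF conjI[OF K(1,2)]]])
       (use C01_measurable[OF spec[OF f0(1)] Kl] uK in auto)
  define f where "f k = f0 (r k)" for k
  have f: "f k \<in> C01 \<Omega>" for k
    by (simp add: f_def f0(1))
  have fm [measurable]: "f k \<in> borel_measurable (lebesgue_on \<Omega>)" "hgrad (f k) \<in> borel_measurable (lebesgue_on \<Omega>)" for k
    using C01_measurable[OF f O] by auto
  have fG: "Lp_null (lebesgue_on \<Omega>) p (\<lambda>k \<xi>. hgrad (f k) \<xi> - G \<xi>)"
    using Lp_null_subseq[OF f0(2) r] by (simp add: f_def)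
  have fK: "Lp_null (lebesgue_on K) p (\<lambda>k \<xi>. f k \<xi> - u \<xi>)"
    using Lp_null_subseq[OF f0(3)[rule_format, OF conjI[OF K(1,2)]] r] by (simp add: f_def)
  have flim: "AE \<xi> in lebesgue_on \<Omega>. \<xi> \<in> K \<longrightarrow> (\<lambda>k. f k \<xi>) \<longlonglongrightarrow> u \<xi>"
    using AE_lebesgue_on_support[OF Kl O lim] by eventually_elim (auto simp: f_def LIM_zero_iff)
  \<comment> \<open>Cut off at \<open>K\<close>, the local convergence of \<open>f k\<close> to
    \<open>u\<close> becomes convergence on all of \<open>\<Omega>\<close>.\<close>
  define d where "d k \<xi> = indicator K \<xi> * (f k \<xi> - u \<xi>)" for k \<xi>
  have KO: "K \<in> sets (lebesgue_on \<Omega>)"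
    using Kl O K(2) by (simp add: sets_restrict_space_iff)
  have dm [measurable]: "d k \<in> borel_measurable (lebesgue_on \<Omega>)" for k
    using KO unfolding d_def by measurable
  have d: "Lp_null (lebesgue_on \<Omega>) p d"
  proof -
    have "(\<integral>\<^sup>+\<xi>. ennreal (norm (d k \<xi>) powr p) \<partial>lebesgue_on \<Omega>) =
        (\<integral>\<^sup>+\<xi>. ennreal (norm (f k \<xi> - u \<xi>) powr p) \<partial>lebesgue_on K)" for k
    proof -
      have "(\<integral>\<^sup>+\<xi>. ennreal (norm (d k \<xi>) powr p) \<partial>lebesgue_on \<Omega>) =
          (\<integral>\<^sup>+\<xi>. ennreal (norm (d k \<xi>) powr p) \<partial>lebesgue_on K)"
        using Kl O K(2) assms(2) by (intro nn_integral_lebesgue_on_support) (auto simp: d_def)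
      also have "\<dots> = (\<integral>\<^sup>+\<xi>. ennreal (norm (f k \<xi> - u \<xi>) powr p) \<partial>lebesgue_on K)"
        by (intro nn_integral_cong) (auto simp: d_def)
      finally show ?thesis .
    qed
    with fK show ?thesis
      by (simp add: Lp_null_def)
  qed
  have gc: "continuous_on UNIV g"
    using g(1) by (auto simp: continuous_on_eq_continuous_within intro: DERIV_isCont)
  have [measurable]: "g \<in> borel_measurable borel" "g' \<in> borel_measurable borel"
    using gc g(2) by (auto intro: borel_measurable_continuous_onI)
  have Lip: "\<bar>g x - g y\<bar> \<le> L * \<bar>x - y\<bar>" for x y
    by (rule Lipschitz_of_deriv_bound[OF g(1,3)])
  \<comment> \<open>\<open>m\<close> stands for both \<open>\<bar>\<psi> \<xi>\<bar>\<close> and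
    \<open>norm (hgrad \<psi> \<xi>)\<close>.\<close>
  have gd: "\<bar>g (f k \<xi>) - g (u \<xi>)\<bar> * m \<le> L * M * \<bar>d k \<xi>\<bar>" if "0 \<le> m" "m \<le> M" "\<xi> \<notin> K \<Longrightarrow> m = 0" for k \<xi> m
  proof (cases "\<xi> \<in> K")
    case True
    have "\<bar>g (f k \<xi>) - g (u \<xi>)\<bar> * m \<le> (L * \<bar>f k \<xi> - u \<xi>\<bar>) * M"
      using Lip that \<open>0 \<le> L\<close> by (intro mult_mono) auto
    with True show ?thesis
      by (simp add: d_def mult_ac)
  qed (use that in \<open>simp add: d_def\<close>)
  let ?h = "\<lambda>k \<xi>. g (f k \<xi>) * \<psi> \<xi>"
  let ?H = "\<lambda>\<xi>. (g' (u \<xi>) * \<psi> \<xi>) *\<^sub>R G \<xi> + g (u \<xi>) *\<^sub>R hgrad \<psi> \<xi>"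
  have hgrad_h: "hgrad (?h k) \<xi> = (g' (f k \<xi>) * \<psi> \<xi>) *\<^sub>R hgrad (f k) \<xi> + g (f k \<xi>) *\<^sub>R hgrad \<psi> \<xi>" for k \<xi>
  proof -
    have df: "f k differentiable (at \<xi>)" "\<psi> differentiable (at \<xi>)"
      using f[of k] assms(4) by (auto simp: C01_def Ck_1_differentiable)
    show ?thesis
      using hgrad_mult[OF differentiable_comp_real[OF df(1) g(1)] df(2)] hgrad_comp[OF df(1) g(1)]
      by (simp add: mult.commute)
  qed
  \<comment> \<open>The error of the gradient splits into three parts. In \<open>a\<close> the
    factor \<open>g' (f k)\<close> stays bounded while the gradients converge; in \<open>b\<close>
    that factor itself converges, dominated by a multiple of \<open>norm (G \<xi>)\<close>; in
    \<open>c\<close> the values converge because \<open>g\<close> is Lipschitz.\<close>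
  have a: "Lp_null (lebesgue_on \<Omega>) p (\<lambda>k \<xi>. (g' (f k \<xi>) * \<psi> \<xi>) *\<^sub>R (hgrad (f k) \<xi> - G \<xi>))"
  proof (rule Lp_null_bound[OF _ fG, where C = "L * M"])
    have "\<bar>g' x\<bar> * \<bar>\<psi> \<xi>\<bar> \<le> L * M" for x \<xi>
      using g(3) \<psi>M \<open>0 \<le> L\<close> by (intro mult_mono) auto
    then show "AE \<xi> in lebesgue_on \<Omega>. norm ((g' (f k \<xi>) * \<psi> \<xi>) *\<^sub>R (hgrad (f k) \<xi> - G \<xi>))
        \<le> L * M * norm (hgrad (f k) \<xi> - G \<xi>)" for k
      by (intro AE_I2) (auto simp: abs_mult intro: mult_right_mono)
  qed (use assms(2) \<open>0 \<le> L\<close> K(3) in auto)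
  have b: "Lp_null (lebesgue_on \<Omega>) p (\<lambda>k \<xi>. ((g' (f k \<xi>) - g' (u \<xi>)) * \<psi> \<xi>) *\<^sub>R G \<xi>)"
  proof (rule Lp_null_dominated[where w = "\<lambda>\<xi>. 2 * L * M * norm (G \<xi>)"])
    show "AE \<xi> in lebesgue_on \<Omega>. (\<lambda>k. ((g' (f k \<xi>) - g' (u \<xi>)) * \<psi> \<xi>) *\<^sub>R G \<xi>) \<longlonglongrightarrow> 0"
      using flim
    proof eventually_elim
      case (elim \<xi>)
      show ?case
      proof (cases "\<xi> \<in> K")
        case True
        have "isCont g' (u \<xi>)"
          using g(2) by (simp add: continuous_on_eq_continuous_at)
        then have "(\<lambda>k. g' (f k \<xi>)) \<longlonglongrightarrow> g' (u \<xi>)"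
          using elim True by (auto intro: isCont_tendsto_compose)
        then have "(\<lambda>k. ((g' (f k \<xi>) - g' (u \<xi>)) * \<psi> \<xi>) *\<^sub>R G \<xi>) \<longlonglongrightarrow> (0 * \<psi> \<xi>) *\<^sub>R G \<xi>"
          by (intro tendsto_intros) (simp add: LIM_zero)
        then show ?thesis
          by simp
      qed (simp add: \<psi>0)
    qed
    have "\<bar>g' x - g' y\<bar> * \<bar>\<psi> \<xi>\<bar> \<le> (2 * L) * M" for x y \<xi>
      using g(3)[of x] g(3)[of y] \<psi>M \<open>0 \<le> L\<close> by (intro mult_mono) auto
    then show "AE \<xi> in lebesgue_on \<Omega>. norm (((g' (f k \<xi>) - g' (u \<xi>)) * \<psi> \<xi>) *\<^sub>R G \<xi>) \<le> 2 * L * M * norm (G \<xi>)" for k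
      by (intro AE_I2) (auto simp: abs_mult intro: mult_right_mono)
    have "(\<integral>\<^sup>+\<xi>. ennreal ((2 * L * M * norm (G \<xi>)) powr p) \<partial>lebesgue_on \<Omega>) =
        ennreal ((2 * L * M) powr p) * (\<integral>\<^sup>+\<xi>. ennreal (norm (G \<xi>) powr p) \<partial>lebesgue_on \<Omega>)"
      using \<open>0 \<le> L\<close> K(3) by (subst nn_integral_cmult[symmetric]) (auto simp: powr_mult ennreal_mult)
    also have "\<dots> < \<infinity>"
      using S0_grad_Lp[OF assms(1-3)] by (simp add: ennreal_mult_less_top)
    finally show "(\<integral>\<^sup>+\<xi>. ennreal ((2 * L * M * norm (G \<xi>)) powr p) \<partial>lebesgue_on \<Omega>) < \<infinity>" .
  qed (use assms(2) in auto)
  have c: "Lp_null (lebesgue_on \<Omega>) p (\<lambda>k \<xi>. (g (f k \<xi>) - g (u \<xi>)) *\<^sub>R hgrad \<psi> \<xi>)"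
    by (rule Lp_null_bound[OF _ d, where C = "L * M"])
       (use assms(2) \<open>0 \<le> L\<close> K(3) gd \<psi>0 \<psi>M in auto)
  have e: "Lp_null (lebesgue_on \<Omega>) p (\<lambda>k \<xi>. ?h k \<xi> - g (u \<xi>) * \<psi> \<xi>)"
    by (rule Lp_null_bound[OF _ d, where C = "L * M"])
       (use assms(2) \<open>0 \<le> L\<close> K(3) gd \<psi>0 \<psi>M in \<open>auto simp: abs_mult simp flip: left_diff_distrib\<close>)
  have ab: "Lp_null (lebesgue_on \<Omega>) p (\<lambda>k \<xi>. (g' (f k \<xi>) * \<psi> \<xi>) *\<^sub>R (hgrad (f k) \<xi> - G \<xi>)
      + ((g' (f k \<xi>) - g' (u \<xi>)) * \<psi> \<xi>) *\<^sub>R G \<xi>)"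
    by (rule Lp_null_add[OF _ a b]) (use assms(2) in auto)
  have abc: "Lp_null (lebesgue_on \<Omega>) p (\<lambda>k \<xi>. ((g' (f k \<xi>) * \<psi> \<xi>) *\<^sub>R (hgrad (f k) \<xi> - G \<xi>)
      + ((g' (f k \<xi>) - g' (u \<xi>)) * \<psi> \<xi>) *\<^sub>R G \<xi>) + (g (f k \<xi>) - g (u \<xi>)) *\<^sub>R hgrad \<psi> \<xi>)"
    by (rule Lp_null_add[OF _ ab c]) (use assms(2) in auto)
  have grad: "Lp_null (lebesgue_on \<Omega>) p (\<lambda>k \<xi>. hgrad (?h k) \<xi> - ?H \<xi>)"
    using abc unfolding hgrad_h by (simp add: algebra_simps)
  \<comment> \<open>The products converge on all of \<open>\<Omega>\<close>, since
    \<open>\<psi>\<close> confines them to \<open>K\<close>; any compact subset follows by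
    monotonicity.\<close>
  have loc: "Lp_null (lebesgue_on K') p (\<lambda>k \<xi>. ?h k \<xi> - g (u \<xi>) * \<psi> \<xi>)" if "compact K'" "K' \<subseteq> \<Omega>" for K'
    using e lmeasurable_compact[OF that(1)] O that(2) unfolding Lp_null_def
    by (elim ennreal_tendsto_0_le) (auto intro: nn_integral_lebesgue_on_mono)
  have "?h k \<in> C01 \<Omega>" for k
    using f[of k] by (intro C01_mult_comp[OF _ assms(4) g(1,2)]) (simp add: C01_def)
  then show ?thesis
    unfolding S0_grad_iff_Lp_null
    by (intro conjI exI[of _ ?h] allI impI grad loc) auto
qed

section \<open>Testing the inequality with \<open>g(v) \<phi>\<^sup>p\<close>\<close>

text \<open>The chain rule asks for a function that is \<open>C^1\<close> on the whole line, since
  approximants may be negative. Cutting at zero keeps the power \<open>C^1\<close> because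
  \<open>s > 1\<close>: the difference quotient at zero is at most
  \<open>\<bar>h\<bar> powr (s - 1)\<close>.\<close>

lemma has_real_derivative_pos_part_powr:
  fixes s x :: real
  assumes "1 < s"
  shows "((\<lambda>x. max x 0 powr s) has_real_derivative s * max x 0 powr (s - 1)) (at x)"
proof -
  consider "x < 0" | "x = 0" | "0 < x"
    by linarith
  then show ?thesis
  proof cases
    case 1
    have "((\<lambda>_. 0) has_real_derivative 0) (at x)"
      by simp
    moreover have "eventually (\<lambda>y. 0 = max y 0 powr s) (nhds x)"
      using eventually_nhds_in_open[of "{..<0}" x] 1 by (auto elim: eventually_mono)
    ultimately have "((\<lambda>x. max x 0 powr s) has_real_derivative 0) (at x)"
      using DERIV_cong_ev[of x x "\<lambda>_. 0" "\<lambda>x. max x 0 powr s" 0 0] by simp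
    then show ?thesis
      using 1 by simp
  next
    case 2
    have lim: "((\<lambda>h. \<bar>h\<bar> powr (s - 1)) \<longlongrightarrow> 0) (at 0)"
      by (rule tendsto_zero_powrI[OF _ tendsto_const]) (use assms in \<open>auto intro!: tendsto_eq_intros\<close>)
    have "((\<lambda>h. (max (0 + h) 0 powr s - max 0 0 powr s) / h) \<longlongrightarrow> 0) (at 0)"
    proof (rule Lim_null_comparison[OF always_eventually lim], intro allI)
      fix h :: real
      show "norm ((max (0 + h) 0 powr s - max 0 0 powr s) / h) \<le> \<bar>h\<bar> powr (s - 1)"
        by (cases "h > 0") (auto simp: powr_diff intro: divide_nonneg_nonpos)
    qed
    then show ?thesis
      using 2 assms by (simp add: DERIV_def)
  next
    case 3
    have "((\<lambda>x. x powr s) has_real_derivative s * x powr (s - 1)) (at x)"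
      using 3 by (rule has_real_derivative_powr)
    moreover have "eventually (\<lambda>y. y powr s = max y 0 powr s) (nhds x)"
      using eventually_nhds_in_open[of "{0<..}" x] 3 by (auto elim: eventually_mono)
    ultimately have "((\<lambda>x. max x 0 powr s) has_real_derivative s * x powr (s - 1)) (at x)"
      using DERIV_cong_ev[of x x "\<lambda>x. x powr s" "\<lambda>x. max x 0 powr s"] by simp
    then show ?thesis
      using 3 by simp
  qed
qed

lemma C01_powr:
  fixes \<phi> :: "'n::finite heis \<Rightarrow> real"
  assumes "1 < p" "\<phi> \<in> C01 \<Omega>" "\<And>\<xi>. 0 \<le> \<phi> \<xi>"
  shows "(\<lambda>\<xi>. \<phi> \<xi> powr p) \<in> C01 \<Omega>"
    and "hgrad (\<lambda>\<xi>. \<phi> \<xi> powr p) \<xi> = (p * \<phi> \<xi> powr (p - 1)) *\<^sub>R hgrad \<phi> \<xi>"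
proof -
  have eq: "(\<lambda>\<xi>. \<phi> \<xi> powr p) = (\<lambda>\<xi>. max (\<phi> \<xi>) 0 powr p)"
    using assms(3) by (simp add: max_absorb1)
  note deriv = has_real_derivative_pos_part_powr[OF assms(1)]
  have "continuous_on UNIV (\<lambda>x. p * max x 0 powr (p - 1))"
    using assms(1) by (intro continuous_intros continuous_on_powr') auto
  then show "(\<lambda>\<xi>. \<phi> \<xi> powr p) \<in> C01 \<Omega>"
    unfolding eq using assms(1) by (intro C01_comp[OF assms(2) _ deriv]) auto
  show "hgrad (\<lambda>\<xi>. \<phi> \<xi> powr p) \<xi> = (p * \<phi> \<xi> powr (p - 1)) *\<^sub>R hgrad \<phi> \<xi>"
    unfolding eq using hgrad_comp[OF _ deriv, of \<phi> \<xi>] assms(2,3)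
    by (simp add: C01_def Ck_1_differentiable max_absorb1)
qed

text \<open>Applied with \<open>a\<close> the norm of \<open>Dv\<close>, \<open>b\<close> the value
  of \<phi>, \<open>m\<close> the norm of its gradient, \<open>G = g (v \<xi>)\<close> and
  \<open>H = g' (v \<xi>)\<close>. Young's inequality has exponents \<open>p\<close> and
  \<open>p / (p - 1)\<close>. The opposite powers of \<open>H\<close> cancel in \<open>X * Y\<close>
  and make \<open>Y powr (p / (p - 1))\<close> exactly the gradient term; the factor
  \<open>p\<close> goes entirely to \<open>X\<close>, so that \<open>X powr p / p\<close> carries
  \<open>p powr (p - 1)\<close>.\<close>

lemma Caccioppoli_Young:
  fixes p a b m G H :: real
  assumes "1 < p" "0 \<le> a" "0 \<le> b" "0 \<le> m" "0 \<le> G" "0 < H"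
  shows "p * G * b powr (p - 1) * a powr (p - 1) * m
    \<le> (p - 1) / p * (H * b powr p * a powr p) + p powr (p - 1) * (G powr p * H powr (1 - p) * m powr p)"
proof -
  define X where "X = p * G * H powr (- (p - 1) / p) * m"
  define Y where "Y = H powr ((p - 1) / p) * b powr (p - 1) * a powr (p - 1)"
  have "X * Y \<le> X powr p / p + Y powr (p / (p - 1)) / (p / (p - 1))"
    using assms by (intro Youngs_inequality) (auto simp: X_def Y_def field_simps)
  moreover have "H powr (- (p - 1) / p) * H powr ((p - 1) / p) = 1"
    using assms by (simp flip: powr_add add: diff_divide_distrib)
  then have "X * Y = p * G * b powr (p - 1) * a powr (p - 1) * m"
    unfolding X_def Y_def by (simp add: mult_ac)
  moreover have "X powr p = p * (p powr (p - 1) * (G powr p * H powr (1 - p) * m powr p))"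
  proof -
    have "X powr p = p powr p * G powr p * (H powr (- (p - 1) / p)) powr p * m powr p"
      using assms unfolding X_def by (simp add: powr_mult)
    also have "(H powr (- (p - 1) / p)) powr p = H powr (1 - p)"
      using assms by (simp add: powr_powr)
    also have "p powr p = p * p powr (p - 1)"
      using assms by (simp add: powr_diff)
    finally show ?thesis
      by (simp add: mult_ac)
  qed
  moreover have "Y powr (p / (p - 1)) = H * b powr p * a powr p"
    using assms unfolding Y_def by (simp add: powr_mult powr_powr)
  ultimately show ?thesis
    using assms by (simp add: field_simps)
qed

lemma integrable_of_nn_integral_bound:
  fixes F w :: "'a \<Rightarrow> real"
  assumes [measurable]: "F \<in> borel_measurable M" "w \<in> borel_measurable M"
    and "AE x in M. \<bar>F x\<bar> \<le> C * w x" "(\<integral>\<^sup>+x. ennreal (w x) \<partial>M) < \<infinity>" "0 \<le> C" "\<And>x. 0 \<le> w x"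
  shows "integrable M F"
proof (rule Bochner_Integration.integrable_bound[where f = "\<lambda>x. C * w x"])
  have "integrable M w"
    using assms by (intro integrableI_nonneg) auto
  then show "integrable M (\<lambda>x. C * w x)"
    by simp
  show "AE x in M. norm (F x) \<le> norm (C * w x)"
    using assms(3) by eventually_elim auto
qed simp

text \<open>Supplies the majorant for all terms without \<open>Dv\<close>; the shift by 1 lets
  \<open>(1 + v) powr p\<close> dominate lower powers of \<open>v\<close> as well.\<close>

lemma nn_integral_shifted_powr_finite:
  assumes "open \<Omega>" "1 < p" "S0_grad p \<Omega> u G" "compact K" "K \<subseteq> \<Omega>"
  shows "(\<integral>\<^sup>+\<xi>. ennreal (indicator K \<xi> * \<bar>1 + u \<xi>\<bar> powr p) \<partial>lebesgue_on \<Omega>) < \<infinity>"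
proof -
  have K: "K \<in> sets lebesgue"
    using lmeasurable_compact[OF assms(4)] by auto
  have [measurable]: "u \<in> borel_measurable (lebesgue_on K)"
    by (rule measurable_restrict_mono[OF S0_grad_approx(2)[OF assms(3)] assms(5)])
  have "(\<integral>\<^sup>+\<xi>. ennreal (indicator K \<xi> * \<bar>1 + u \<xi>\<bar> powr p) \<partial>lebesgue_on \<Omega>) =
      (\<integral>\<^sup>+\<xi>. ennreal (indicator K \<xi> * \<bar>1 + u \<xi>\<bar> powr p) \<partial>lebesgue_on K)"
    using K assms(1,5) by (intro nn_integral_lebesgue_on_support) auto
  also have "\<dots> = (\<integral>\<^sup>+\<xi>. ennreal (norm (1 + u \<xi>) powr p) \<partial>lebesgue_on K)"
    by (intro nn_integral_cong) auto
  also have "\<dots> \<le> ennreal (2 powr p) * ((\<integral>\<^sup>+\<xi>. ennreal (norm (1::real) powr p) \<partial>lebesgue_on K) +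
      (\<integral>\<^sup>+\<xi>. ennreal (norm (u \<xi>) powr p) \<partial>lebesgue_on K))"
    using assms(2) by (intro nn_integral_powr_norm_add_le) auto
  also have "\<dots> < \<infinity>"
    using nn_integral_lebesgue_on_bounded_finite[OF assms(4), of "\<lambda>_. norm (1::real) powr p" 1]
      S0_grad_local_Lp[OF assms(1) _ assms(3-5)] assms(2)
    by (simp add: ennreal_mult_less_top)
  finally show ?thesis .
qed

text \<open>All integrals involved are finite for such a \<open>g\<close>, so the absorption takes
  place among real numbers. The result is then restated with nonnegative integrals, the form in
  which the limit is taken.\<close>

lemma subsolution_test_inequality:
  fixes \<Omega> :: "'n::finite heis set"
  assumes "open \<Omega>" "1 < p" and sub: "subsolution p lam \<Omega> v Dv"
    and pos: "AE \<xi> in lebesgue_on \<Omega>. 0 < v \<xi>"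
    and \<phi>: "\<phi> \<in> C01 \<Omega>" "\<And>\<xi>. 0 \<le> \<phi> \<xi>"
    and g: "\<And>x. (g has_real_derivative g' x) (at x)" "continuous_on UNIV g'" "\<And>x. \<bar>g' x\<bar> \<le> L"
    and g_pos: "\<And>x. 0 < x \<Longrightarrow> 0 < g' x" "\<And>x. 0 < x \<Longrightarrow> 0 \<le> g x"
    and g_le: "\<And>x. 0 < x \<Longrightarrow> g x \<le> c * ((1 + x) * g' x)" "0 \<le> c"
  shows "(\<integral>\<^sup>+\<xi>. ennreal (1 / p * (g' (v \<xi>) * \<phi> \<xi> powr p * norm (Dv \<xi>) powr p)
        + max (- lam) 0 * (v \<xi> powr (p - 1) * g (v \<xi>) * \<phi> \<xi> powr p)) \<partial>lebesgue_on \<Omega>)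
    \<le> (\<integral>\<^sup>+\<xi>. ennreal (p powr (p - 1) * (g (v \<xi>) powr p * g' (v \<xi>) powr (1 - p) * norm (hgrad \<phi> \<xi>) powr p)
        + max lam 0 * (v \<xi> powr (p - 1) * g (v \<xi>) * \<phi> \<xi> powr p)) \<partial>lebesgue_on \<Omega>)"
proof -
  define M where "M = lebesgue_on \<Omega>"
  \<comment> \<open>\<open>A\<close> is the gradient term, \<open>B\<close> the zero-order term,
    \<open>C\<close> what Young's inequality leaves over; \<open>T\<close> is the test function,
    \<open>DT\<close> its horizontal gradient and \<open>E\<close> the integrand of the tested
    equation.\<close>
  define A where "A \<xi> = g' (v \<xi>) * \<phi> \<xi> powr p * norm (Dv \<xi>) powr p" for \<xi>
  define B where "B \<xi> = v \<xi> powr (p - 1) * g (v \<xi>) * \<phi> \<xi> powr p" for \<xi>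
  define C where "C \<xi> = g (v \<xi>) powr p * g' (v \<xi>) powr (1 - p) * norm (hgrad \<phi> \<xi>) powr p" for \<xi>
  define T where "T \<xi> = g (v \<xi>) * \<phi> \<xi> powr p" for \<xi>
  define DT where "DT \<xi> = (g' (v \<xi>) * \<phi> \<xi> powr p) *\<^sub>R Dv \<xi> + g (v \<xi>) *\<^sub>R hgrad (\<lambda>\<xi>. \<phi> \<xi> powr p) \<xi>" for \<xi>
  define E where "E \<xi> = norm (Dv \<xi>) powr (p - 2) * (Dv \<xi> \<bullet> DT \<xi>)" for \<xi>
  have O: "\<Omega> \<in> sets lebesgue"
    using assms(1) by auto
  have S: "S0_grad p \<Omega> v Dv"
    using sub by (simp add: subsolution_def)
  have "0 \<le> L"
    using g(3)[of 0] by linarith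
  note \<psi> = C01_powr[OF assms(2) \<phi>]
  have [measurable]: "v \<in> borel_measurable M" "Dv \<in> borel_measurable M"
    using S0_grad_approx(2,3)[OF S] by (auto simp: M_def)
  have [measurable]: "\<phi> \<in> borel_measurable M" "hgrad \<phi> \<in> borel_measurable M"
      "hgrad (\<lambda>\<xi>. \<phi> \<xi> powr p) \<in> borel_measurable M"
    using C01_measurable[OF \<phi>(1) O] C01_measurable[OF \<psi>(1) O] by (auto simp: M_def)
  have "continuous_on UNIV g"
    using g(1) by (auto simp: continuous_on_eq_continuous_within intro: DERIV_isCont)
  then have [measurable]: "g \<in> borel_measurable borel" "g' \<in> borel_measurable borel"
    using g(2) by (auto intro: borel_measurable_continuous_onI)
  have Am [measurable]: "A \<in> borel_measurable M" and Bm [measurable]: "B \<in> borel_measurable M"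
    and Cm [measurable]: "C \<in> borel_measurable M" and Em [measurable]: "E \<in> borel_measurable M"
    unfolding A_def B_def C_def E_def DT_def by measurable
  obtain K m where K: "compact K" "K \<subseteq> \<Omega>" "m > 0"
      and \<phi>0: "\<And>\<xi>. \<xi> \<notin> K \<Longrightarrow> \<phi> \<xi> = 0" "\<And>\<xi>. \<xi> \<notin> K \<Longrightarrow> hgrad \<phi> \<xi> = 0"
      and \<phi>m: "\<And>\<xi>. \<bar>\<phi> \<xi>\<bar> \<le> m" "\<And>\<xi>. norm (hgrad \<phi> \<xi>) \<le> m"
    using C01_bounded[OF \<phi>(1)] by blast
  define W where "W \<xi> = indicator K \<xi> * \<bar>1 + v \<xi>\<bar> powr p" for \<xi>
  have KM: "K \<in> sets M"
    using lmeasurable_compact[OF K(1)] O K(2) by (auto simp: M_def sets_restrict_space_iff)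
  then have Wm [measurable]: "W \<in> borel_measurable M"
    unfolding W_def by measurable
  have W: "(\<integral>\<^sup>+\<xi>. ennreal (W \<xi>) \<partial>M) < \<infinity>"
    using nn_integral_shifted_powr_finite[OF assms(1,2) S K(1,2)] by (simp add: W_def M_def)
  have \<phi>p: "\<phi> \<xi> powr p \<le> m powr p" "norm (hgrad \<phi> \<xi>) powr p \<le> m powr p" for \<xi>
    using \<phi>m[of \<xi>] \<phi>(2)[of \<xi>] assms(2) by (auto intro!: powr_mono2)
  have pos': "AE \<xi> in M. 0 < v \<xi>"
    using pos unfolding M_def .
  have A: "integrable M A"
  proof (rule integrable_of_nn_integral_bound[where w = "\<lambda>\<xi>. norm (Dv \<xi>) powr p" and C = "L * m powr p"])
    have "\<bar>g' (v \<xi>)\<bar> * \<phi> \<xi> powr p \<le> L * m powr p" for \<xi>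
      using g(3) \<phi>p \<open>0 \<le> L\<close> by (intro mult_mono) auto
    then show "AE \<xi> in M. \<bar>A \<xi>\<bar> \<le> L * m powr p * norm (Dv \<xi>) powr p"
      by (intro AE_I2) (auto simp: A_def abs_mult intro: mult_right_mono)
    show "(\<integral>\<^sup>+\<xi>. ennreal (norm (Dv \<xi>) powr p) \<partial>M) < \<infinity>"
      using S0_grad_Lp[OF assms(1) _ S] assms(2) by (simp add: M_def)
  qed (use \<open>0 \<le> L\<close> in auto)
  have B: "integrable M B"
  proof (rule integrable_of_nn_integral_bound[where w = W and C = "c * L * m powr p"])
    show "AE \<xi> in M. \<bar>B \<xi>\<bar> \<le> c * L * m powr p * W \<xi>"
      using pos'
    proof eventually_elim
      case (elim \<xi>)
      show ?case
      proof (cases "\<xi> \<in> K")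
        case True
        have "g (v \<xi>) \<le> c * ((1 + v \<xi>) * L)"
          using g_le elim g(3)[of "v \<xi>"] by (smt (verit) mult_left_mono)
        then have "v \<xi> powr (p - 1) * g (v \<xi>) \<le> (1 + v \<xi>) powr (p - 1) * (c * ((1 + v \<xi>) * L))"
          using elim assms(2) g_pos(2)[OF elim] by (intro mult_mono powr_mono2) auto
        also have "\<dots> = c * L * (1 + v \<xi>) powr p"
          using elim by (simp add: powr_diff)
        finally have "v \<xi> powr (p - 1) * g (v \<xi>) * \<phi> \<xi> powr p \<le> c * L * (1 + v \<xi>) powr p * m powr p"
          by (rule mult_mono[OF _ \<phi>p(1)]) (use \<open>0 \<le> L\<close> g_le(2) in auto)
        then show ?thesis
          using True elim g_pos(2)[OF elim] by (simp add: B_def W_def abs_mult mult_ac)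
      qed (use assms(2) in \<open>simp add: B_def W_def \<phi>0\<close>)
    qed
  qed (use W \<open>0 \<le> L\<close> g_le(2) in \<open>auto simp: W_def\<close>)
  have C: "integrable M C"
  proof (rule integrable_of_nn_integral_bound[where w = W and C = "c powr p * L * m powr p"])
    show "AE \<xi> in M. \<bar>C \<xi>\<bar> \<le> c powr p * L * m powr p * W \<xi>"
      using pos'
    proof eventually_elim
      case (elim \<xi>)
      show ?case
      proof (cases "\<xi> \<in> K")
        case True
        have "g (v \<xi>) powr p * g' (v \<xi>) powr (1 - p) \<le>
            (c * ((1 + v \<xi>) * g' (v \<xi>))) powr p * g' (v \<xi>) powr (1 - p)"
          using g_le(1)[OF elim] g_pos(2)[OF elim] assms(2) by (intro mult_right_mono powr_mono2) auto
        also have "\<dots> = c powr p * (1 + v \<xi>) powr p * g' (v \<xi>)"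
          using g_pos(1)[OF elim] g_le(2) elim by (simp add: powr_mult powr_diff)
        also have "\<dots> \<le> c powr p * (1 + v \<xi>) powr p * L"
          using g(3)[of "v \<xi>"] by (intro mult_left_mono) auto
        finally have "C \<xi> \<le> c powr p * (1 + v \<xi>) powr p * L * m powr p"
          unfolding C_def by (rule mult_mono[OF _ \<phi>p(2)]) (use \<open>0 \<le> L\<close> in auto)
        then show ?thesis
          using True elim by (simp add: C_def W_def mult_ac)
      qed (use assms(2) in \<open>simp add: C_def W_def \<phi>0\<close>)
    qed
  qed (use W \<open>0 \<le> L\<close> g_le(2) in \<open>auto simp: W_def\<close>)
  \<comment> \<open>\<open>E - A\<close> is the mixed term with \<open>hgrad \<phi>\<close>. Its
    absolute value is bounded, because this yields both the integrability of \<open>E\<close> and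
    the lower bound for its integral.\<close>
  have E_eq: "AE \<xi> in M. \<bar>E \<xi> - A \<xi>\<bar> \<le> (p - 1) / p * A \<xi> + p powr (p - 1) * C \<xi>"
    using pos'
  proof eventually_elim
    case (elim \<xi>)
    \<comment> \<open>Where \<open>Dv\<close> vanishes both sides are zero:
      \<open>0 powr r = 0\<close> for every exponent, also for the negative \<open>p - 2\<close>
      when \<open>p < 2\<close>.\<close>
    have DD: "norm (Dv \<xi>) powr (p - 2) * (Dv \<xi> \<bullet> Dv \<xi>) = norm (Dv \<xi>) powr p"
      by (cases "Dv \<xi> = 0") (simp_all add: dot_square_norm powr_diff)
    have "\<bar>Dv \<xi> \<bullet> hgrad \<phi> \<xi>\<bar> \<le> norm (Dv \<xi>) * norm (hgrad \<phi> \<xi>)"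
      by (rule Cauchy_Schwarz_ineq2)
    then have CS: "norm (Dv \<xi>) powr (p - 2) * \<bar>Dv \<xi> \<bullet> hgrad \<phi> \<xi>\<bar> \<le>
        norm (Dv \<xi>) powr (p - 2) * (norm (Dv \<xi>) * norm (hgrad \<phi> \<xi>))"
      by (intro mult_left_mono) auto
    have D1: "norm (Dv \<xi>) powr (p - 2) * (norm (Dv \<xi>) * norm (hgrad \<phi> \<xi>)) =
        norm (Dv \<xi>) powr (p - 1) * norm (hgrad \<phi> \<xi>)"
      by (cases "Dv \<xi> = 0") (simp_all add: powr_diff power2_eq_square)
    have "E \<xi> = A \<xi> + g (v \<xi>) * p * \<phi> \<xi> powr (p - 1) * (norm (Dv \<xi>) powr (p - 2) * (Dv \<xi> \<bullet> hgrad \<phi> \<xi>))"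
      unfolding E_def DT_def A_def \<psi>(2) DD[symmetric] by (simp add: inner_add_right algebra_simps)
    then have "\<bar>E \<xi> - A \<xi>\<bar> = p * g (v \<xi>) * \<phi> \<xi> powr (p - 1) * (norm (Dv \<xi>) powr (p - 2) * \<bar>Dv \<xi> \<bullet> hgrad \<phi> \<xi>\<bar>)"
      using assms(2) g_pos(2)[OF elim] by (simp add: abs_mult)
    also have "\<dots> \<le> p * g (v \<xi>) * \<phi> \<xi> powr (p - 1) * (norm (Dv \<xi>) powr (p - 1) * norm (hgrad \<phi> \<xi>))"
      using CS D1 assms(2) g_pos(2)[OF elim] by (intro mult_left_mono) auto
    also have "\<dots> \<le> (p - 1) / p * A \<xi> + p powr (p - 1) * C \<xi>"
      using Caccioppoli_Young[OF assms(2) norm_ge_zero[of "Dv \<xi>"] \<phi>(2)[of \<xi>]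
          norm_ge_zero[of "hgrad \<phi> \<xi>"] g_pos(2,1)[OF elim]]
      by (simp add: A_def C_def mult_ac)
    finally show ?case .
  qed
  have E: "integrable M E"
  proof (rule Bochner_Integration.integrable_bound[where f = "\<lambda>\<xi>. \<bar>A \<xi>\<bar> + (p - 1) / p * A \<xi> + p powr (p - 1) * C \<xi>"])
    show "AE \<xi> in M. norm (E \<xi>) \<le> norm (\<bar>A \<xi>\<bar> + (p - 1) / p * A \<xi> + p powr (p - 1) * C \<xi>)"
      using E_eq unfolding real_norm_def by eventually_elim linarith
  qed (use A C in auto)
  have B_eq: "AE \<xi> in M. \<bar>v \<xi>\<bar> powr (p - 2) * v \<xi> * T \<xi> = B \<xi>"
    using pos' by eventually_elim (simp add: B_def T_def powr_diff power2_eq_square)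
  have T: "S0_grad p \<Omega> T DT"
    unfolding T_def[abs_def] DT_def[abs_def]
    by (rule S0_grad_comp_mult[OF assms(1) _ S \<psi>(1) g]) (use assms(2) in simp)
  have "AE \<xi> in lebesgue_on \<Omega>. 0 \<le> T \<xi>"
    using pos by eventually_elim (simp add: T_def g_pos)
  moreover have vTm: "(\<lambda>\<xi>. \<bar>v \<xi>\<bar> powr (p - 2) * v \<xi> * T \<xi>) \<in> borel_measurable M"
    unfolding T_def by measurable
  moreover have "integrable (lebesgue_on \<Omega>) (\<lambda>\<xi>. \<bar>v \<xi>\<bar> powr (p - 2) * v \<xi> * T \<xi>)"
    using integrable_cong_AE[OF vTm Bm B_eq] B by (simp add: M_def)
  ultimately have "integral\<^sup>L M E - lam * (\<integral>\<xi>. \<bar>v \<xi>\<bar> powr (p - 2) * v \<xi> * T \<xi> \<partial>M) \<le> 0"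
    using sub T unfolding subsolution_def E_def M_def by blast
  also have "(\<integral>\<xi>. \<bar>v \<xi>\<bar> powr (p - 2) * v \<xi> * T \<xi> \<partial>M) = integral\<^sup>L M B"
    by (rule integral_cong_AE[OF vTm Bm B_eq])
  finally have "integral\<^sup>L M E \<le> lam * integral\<^sup>L M B"
    by simp
  \<comment> \<open>Young's inequality uses up \<open>(p - 1) / p\<close> of the gradient term, so
    the fraction \<open>1 / p\<close> survives.\<close>
  moreover have "(\<integral>\<xi>. 1 / p * A \<xi> - p powr (p - 1) * C \<xi> \<partial>M) \<le> integral\<^sup>L M E"
  proof (rule integral_mono_AE)
    show "AE \<xi> in M. 1 / p * A \<xi> - p powr (p - 1) * C \<xi> \<le> E \<xi>"
      using E_eq
    proof eventually_elim
      case (elim \<xi>)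
      have "(p - 1) / p * A \<xi> = A \<xi> - 1 / p * A \<xi>"
        using assms(2) by (simp add: field_simps)
      from abs_le_D2[OF elim, unfolded this] show ?case
        by linarith
    qed
  qed (use A C E in auto)
  ultimately have "1 / p * integral\<^sup>L M A - p powr (p - 1) * integral\<^sup>L M C \<le> lam * integral\<^sup>L M B"
    using A C by simp
  moreover have "lam * integral\<^sup>L M B = max lam 0 * integral\<^sup>L M B - max (- lam) 0 * integral\<^sup>L M B"
    by (simp add: max_def)
  ultimately have real_le: "(\<integral>\<xi>. 1 / p * A \<xi> + max (- lam) 0 * B \<xi> \<partial>M) \<le>
      (\<integral>\<xi>. p powr (p - 1) * C \<xi> + max lam 0 * B \<xi> \<partial>M)"
    using A B C by simp
  have nonneg: "AE \<xi> in M. 0 \<le> A \<xi> \<and> 0 \<le> B \<xi> \<and> 0 \<le> C \<xi>"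
    using pos' by eventually_elim (auto simp: A_def B_def C_def intro!: mult_nonneg_nonneg less_imp_le[OF g_pos(1)] g_pos(2))
  have "(\<integral>\<^sup>+\<xi>. ennreal (1 / p * A \<xi> + max (- lam) 0 * B \<xi>) \<partial>M) =
      ennreal (\<integral>\<xi>. 1 / p * A \<xi> + max (- lam) 0 * B \<xi> \<partial>M)"
  proof (rule nn_integral_eq_integral)
    show "AE \<xi> in M. 0 \<le> 1 / p * A \<xi> + max (- lam) 0 * B \<xi>"
      using nonneg by eventually_elim (use assms(2) in auto)
  qed (use A B in auto)
  moreover have "(\<integral>\<^sup>+\<xi>. ennreal (p powr (p - 1) * C \<xi> + max lam 0 * B \<xi>) \<partial>M) =
      ennreal (\<integral>\<xi>. p powr (p - 1) * C \<xi> + max lam 0 * B \<xi> \<partial>M)"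
  proof (rule nn_integral_eq_integral)
    show "AE \<xi> in M. 0 \<le> p powr (p - 1) * C \<xi> + max lam 0 * B \<xi>"
      using nonneg by eventually_elim auto
  qed (use B C in auto)
  ultimately show ?thesis
    using real_le by (simp add: A_def B_def C_def M_def ennreal_leI)
qed

section \<open>Removing the truncation\<close>

text \<open>The bounds \<open>g_dom\<close> are uniform in \<open>n\<close>. Their part
  \<open>x powr (p - 1 + s)\<close> is controlled by the limiting right-hand side itself, the part
  \<open>(1 + x) powr p\<close> by the local integrability of \<open>v\<close>.\<close>

lemma subsolution_limit_inequality:
  fixes \<Omega> :: "'n::finite heis set" and g g' :: "nat \<Rightarrow> real \<Rightarrow> real"
  assumes "open \<Omega>" "1 < p" "0 < s" and sub: "subsolution p lam \<Omega> v Dv"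
    and pos: "AE \<xi> in lebesgue_on \<Omega>. 0 < v \<xi>"
    and \<phi>: "\<phi> \<in> C01 \<Omega>" "\<And>\<xi>. 0 \<le> \<phi> \<xi>"
    and g: "\<And>n x. (g n has_real_derivative g' n x) (at x)" "\<And>n. continuous_on UNIV (g' n)"
      "\<And>n x. \<bar>g' n x\<bar> \<le> L n"
    and g_pos: "\<And>n x. 0 < x \<Longrightarrow> 0 < g' n x" "\<And>n x. 0 < x \<Longrightarrow> 0 \<le> g n x"
    and g_le: "\<And>n x. 0 < x \<Longrightarrow> g n x \<le> c * ((1 + x) * g' n x)" "0 \<le> c"
    and g_lim: "\<And>x. 0 < x \<Longrightarrow> (\<lambda>n. g n x) \<longlonglongrightarrow> x powr s"
      "\<And>x. 0 < x \<Longrightarrow> (\<lambda>n. g' n x) \<longlonglongrightarrow> s * x powr (s - 1)"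
    and g_dom: "\<And>n x. 0 < x \<Longrightarrow> g n x powr p * g' n x powr (1 - p) \<le> B * (x powr (p - 1 + s) + (1 + x) powr p)"
      "\<And>n x. 0 < x \<Longrightarrow> x powr (p - 1) * g n x \<le> B * (x powr (p - 1 + s) + (1 + x) powr p)" "0 \<le> B"
  shows "(\<integral>\<^sup>+\<xi>. ennreal (1 / p * (s * v \<xi> powr (s - 1) * \<phi> \<xi> powr p * norm (Dv \<xi>) powr p)
        + max (- lam) 0 * (v \<xi> powr (p - 1 + s) * \<phi> \<xi> powr p)) \<partial>lebesgue_on \<Omega>)
    \<le> (\<integral>\<^sup>+\<xi>. ennreal (p powr (p - 1) * (s powr (1 - p) * v \<xi> powr (p - 1 + s) * norm (hgrad \<phi> \<xi>) powr p)
        + max lam 0 * (v \<xi> powr (p - 1 + s) * \<phi> \<xi> powr p)) \<partial>lebesgue_on \<Omega>)"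
    (is "integral\<^sup>N _ ?F \<le> integral\<^sup>N _ ?G")
\<comment> \<open>Only a finite right-hand side has content, and then \<open>?G\<close> is an
  integrable part of the majorant.\<close>
proof (cases "(\<integral>\<^sup>+\<xi>. ?G \<xi> \<partial>lebesgue_on \<Omega>) = \<infinity>")
  case False
  define M where "M = lebesgue_on \<Omega>"
  define F where "F n \<xi> = ennreal (1 / p * (g' n (v \<xi>) * \<phi> \<xi> powr p * norm (Dv \<xi>) powr p)
      + max (- lam) 0 * (v \<xi> powr (p - 1) * g n (v \<xi>) * \<phi> \<xi> powr p))" for n \<xi>
  define H where "H n \<xi> = ennreal (p powr (p - 1) * (g n (v \<xi>) powr p * g' n (v \<xi>) powr (1 - p) * norm (hgrad \<phi> \<xi>) powr p)
      + max lam 0 * (v \<xi> powr (p - 1) * g n (v \<xi>) * \<phi> \<xi> powr p))" for n \<xi>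
  have O: "\<Omega> \<in> sets lebesgue"
    using assms(1) by auto
  have S: "S0_grad p \<Omega> v Dv"
    using sub by (simp add: subsolution_def)
  have [measurable]: "v \<in> borel_measurable M" "Dv \<in> borel_measurable M"
    using S0_grad_approx(2,3)[OF S] by (auto simp: M_def)
  have [measurable]: "\<phi> \<in> borel_measurable M" "hgrad \<phi> \<in> borel_measurable M"
    using C01_measurable[OF \<phi>(1) O] by (auto simp: M_def)
  have "continuous_on UNIV (g n)" for n
    using g(1) by (auto simp: continuous_on_eq_continuous_within intro: DERIV_isCont)
  then have [measurable]: "g n \<in> borel_measurable borel" "g' n \<in> borel_measurable borel" for n
    using g(2) by (auto intro: borel_measurable_continuous_onI)
  have [measurable]: "F n \<in> borel_measurable M" "H n \<in> borel_measurable M" for n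
    unfolding F_def H_def by measurable
  have [measurable]: "?F \<in> borel_measurable M" "?G \<in> borel_measurable M"
    by measurable
  obtain K m where K: "compact K" "K \<subseteq> \<Omega>" "m > 0"
      and \<phi>0: "\<And>\<xi>. \<xi> \<notin> K \<Longrightarrow> \<phi> \<xi> = 0" "\<And>\<xi>. \<xi> \<notin> K \<Longrightarrow> hgrad \<phi> \<xi> = 0"
      and \<phi>m: "\<And>\<xi>. \<bar>\<phi> \<xi>\<bar> \<le> m" "\<And>\<xi>. norm (hgrad \<phi> \<xi>) \<le> m"
    using C01_bounded[OF \<phi>(1)] by blast
  have \<phi>p: "\<phi> \<xi> powr p \<le> m powr p" "norm (hgrad \<phi> \<xi>) powr p \<le> m powr p" for \<xi>
    using \<phi>m[of \<xi>] \<phi>(2)[of \<xi>] assms(2) by (auto intro!: powr_mono2)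
  define W where "W \<xi> = indicator K \<xi> * \<bar>1 + v \<xi>\<bar> powr p" for \<xi>
  have KM: "K \<in> sets M"
    using lmeasurable_compact[OF K(1)] O K(2) by (auto simp: M_def sets_restrict_space_iff)
  then have Wm [measurable]: "W \<in> borel_measurable M"
    unfolding W_def by measurable
  have W: "(\<integral>\<^sup>+\<xi>. ennreal (W \<xi>) \<partial>M) < \<infinity>"
    using nn_integral_shifted_powr_finite[OF assms(1,2) S K(1,2)] by (simp add: W_def M_def)
  have pos': "AE \<xi> in M. 0 < v \<xi>"
    using pos unfolding M_def .
  \<comment> \<open>\<open>s powr (p - 1)\<close> compensates the factor
    \<open>s powr (1 - p)\<close> inside \<open>?G\<close>, the summand 1 serves the \<lambda> term,
    and the last summand collects the coefficients of \<open>W\<close>.\<close>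
  define N where "N = B * (s powr (p - 1) + 1 + (p powr (p - 1) + max lam 0) * m powr p)"
  define w where "w \<xi> = ennreal N * (?G \<xi> + ennreal (W \<xi>))" for \<xi>
  have "0 \<le> N"
    using g_dom(3) by (auto simp: N_def)
  have H_le: "AE \<xi> in M. H n \<xi> \<le> w \<xi>" for n
    using pos'
  proof eventually_elim
    case (elim \<xi>)
    define X where "X = v \<xi> powr (p - 1 + s)"
    define P where "P = norm (hgrad \<phi> \<xi>) powr p"
    define Q where "Q = \<phi> \<xi> powr p"
    \<comment> \<open>Off \<open>K\<close> both \<open>P\<close> and \<open>Q\<close> vanish; on
      \<open>K\<close> the weight \<open>W \<xi>\<close> equals
      \<open>(1 + v \<xi>) powr p\<close>.\<close>
    have WP: "(1 + v \<xi>) powr p * P \<le> m powr p * W \<xi>" "(1 + v \<xi>) powr p * Q \<le> m powr p * W \<xi>"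
      using elim \<phi>p[of \<xi>] \<phi>0[of \<xi>] assms(2) by (cases "\<xi> \<in> K"; simp add: P_def Q_def W_def)+
    have nn: "0 \<le> X" "0 \<le> P" "0 \<le> Q" "0 \<le> W \<xi>" "0 \<le> B"
      using g_dom(3) by (auto simp: X_def P_def Q_def W_def)
    have 1: "g n (v \<xi>) powr p * g' n (v \<xi>) powr (1 - p) * P \<le> B * (X * P + m powr p * W \<xi>)"
    proof -
      have "g n (v \<xi>) powr p * g' n (v \<xi>) powr (1 - p) * P \<le> B * (X + (1 + v \<xi>) powr p) * P"
        using g_dom(1)[OF elim] nn by (intro mult_right_mono) (auto simp: X_def)
      also have "\<dots> = B * (X * P + (1 + v \<xi>) powr p * P)"
        by (simp add: algebra_simps)
      finally show ?thesis
        using mult_left_mono[OF add_left_mono[OF WP(1)] nn(5)] by (rule order_trans)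
    qed
    have 2: "v \<xi> powr (p - 1) * g n (v \<xi>) * Q \<le> B * (X * Q + m powr p * W \<xi>)"
    proof -
      have "v \<xi> powr (p - 1) * g n (v \<xi>) * Q \<le> B * (X + (1 + v \<xi>) powr p) * Q"
        using g_dom(2)[OF elim] nn by (intro mult_right_mono) (auto simp: X_def)
      also have "\<dots> = B * (X * Q + (1 + v \<xi>) powr p * Q)"
        by (simp add: algebra_simps)
      finally show ?thesis
        using mult_left_mono[OF add_left_mono[OF WP(2)] nn(5)] by (rule order_trans)
    qed
    define R where "R = p powr (p - 1) * (s powr (1 - p) * X * P)"
    define U where "U = max lam 0 * (X * Q)"
    have "0 \<le> R" "0 \<le> U"
      using nn by (auto simp: R_def U_def)
    have R: "p powr (p - 1) * (X * P) = s powr (p - 1) * R"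
    proof -
      have "s powr (p - 1) * s powr (1 - p) = 1"
        using assms(3) by (simp flip: powr_add)
      then show ?thesis
        unfolding R_def by (simp add: mult_ac)
    qed
    have "p powr (p - 1) * (g n (v \<xi>) powr p * g' n (v \<xi>) powr (1 - p) * P)
        + max lam 0 * (v \<xi> powr (p - 1) * g n (v \<xi>) * Q)
      \<le> p powr (p - 1) * (B * (X * P + m powr p * W \<xi>)) + max lam 0 * (B * (X * Q + m powr p * W \<xi>))"
      by (intro add_mono mult_left_mono 1 2) auto
    also have "\<dots> = B * (s powr (p - 1) * R + 1 * U + ((p powr (p - 1) + max lam 0) * m powr p) * W \<xi>)"
      unfolding R[symmetric] U_def by (simp add: algebra_simps)
    also have "\<dots> \<le> B * ((s powr (p - 1) + 1 + (p powr (p - 1) + max lam 0) * m powr p) * (R + U + W \<xi>))"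
    proof -
      have "s powr (p - 1) * R \<le> s powr (p - 1) * (R + U + W \<xi>)" "1 * U \<le> 1 * (R + U + W \<xi>)"
        "((p powr (p - 1) + max lam 0) * m powr p) * W \<xi> \<le> ((p powr (p - 1) + max lam 0) * m powr p) * (R + U + W \<xi>)"
        using nn \<open>0 \<le> R\<close> \<open>0 \<le> U\<close> by (intro mult_left_mono; simp)+
      then show ?thesis
        using nn(5) by (intro mult_left_mono) (auto simp: distrib_right)
    qed
    also have "\<dots> = N * (R + U + W \<xi>)"
      by (simp add: N_def)
    finally have "H n \<xi> \<le> ennreal (N * (R + U + W \<xi>))"
      unfolding H_def P_def Q_def by (rule ennreal_leI)
    also have "\<dots> = w \<xi>"
      using \<open>0 \<le> R\<close> \<open>0 \<le> U\<close> \<open>0 \<le> N\<close> nn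
      by (simp add: w_def R_def U_def X_def P_def Q_def ennreal_mult mult_ac flip: ennreal_plus)
    finally show ?case .
  qed
  have w: "(\<integral>\<^sup>+\<xi>. w \<xi> \<partial>M) < \<infinity>"
  proof -
    have "(\<integral>\<^sup>+\<xi>. w \<xi> \<partial>M) = ennreal N * (integral\<^sup>N M ?G + (\<integral>\<^sup>+\<xi>. ennreal (W \<xi>) \<partial>M))"
      unfolding w_def by (simp add: nn_integral_cmult nn_integral_add)
    also have "\<dots> < \<infinity>"
      using False W by (simp add: ennreal_mult_less_top M_def top.not_eq_extremum)
    finally show ?thesis .
  qed
  have H_lim: "AE \<xi> in M. (\<lambda>n. H n \<xi>) \<longlonglongrightarrow> ?G \<xi>"
    using pos'
  proof eventually_elim
    case (elim \<xi>)
    define x where "x = v \<xi>"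
    have "x > 0"
      using elim by (simp add: x_def)
    \<comment> \<open>The exponents add up as
      \<open>s * p + (s - 1) * (1 - p) = p - 1 + s\<close>.\<close>
    have e1: "(x powr s) powr p * (s * x powr (s - 1)) powr (1 - p) = s powr (1 - p) * x powr (p - 1 + s)"
    proof -
      have "(x powr s) powr p * (s * x powr (s - 1)) powr (1 - p) =
          s powr (1 - p) * (x powr (s * p) * x powr ((s - 1) * (1 - p)))"
        using \<open>x > 0\<close> assms(3) by (simp add: powr_mult powr_powr)
      also have "x powr (s * p) * x powr ((s - 1) * (1 - p)) = x powr (p - 1 + s)"
        by (simp flip: powr_add add: algebra_simps)
      finally show ?thesis .
    qed
    have e2: "x powr (p - 1) * x powr s = x powr (p - 1 + s)"
      by (simp add: powr_add)
    have lim1: "(\<lambda>n. g n x powr p * g' n x powr (1 - p)) \<longlonglongrightarrow> (x powr s) powr p * (s * x powr (s - 1)) powr (1 - p)"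
      using g_lim[OF \<open>x > 0\<close>] \<open>x > 0\<close> assms(3) by (intro tendsto_intros) auto
    have lim2: "(\<lambda>n. x powr (p - 1) * g n x) \<longlonglongrightarrow> x powr (p - 1) * x powr s"
      using g_lim[OF \<open>x > 0\<close>] by (intro tendsto_intros)
    show ?case
      unfolding H_def x_def[symmetric]
      by (intro tendsto_ennrealI tendsto_add tendsto_mult_left tendsto_mult_right lim1[unfolded e1] lim2[unfolded e2])
  qed
  have F_lim: "AE \<xi> in M. (\<lambda>n. F n \<xi>) \<longlonglongrightarrow> ?F \<xi>"
    using pos'
  proof eventually_elim
    case (elim \<xi>)
    have "(\<lambda>n. v \<xi> powr (p - 1) * g n (v \<xi>)) \<longlonglongrightarrow> v \<xi> powr (p - 1) * v \<xi> powr s"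
      using g_lim[OF elim] by (intro tendsto_intros)
    then have "(\<lambda>n. v \<xi> powr (p - 1) * g n (v \<xi>)) \<longlonglongrightarrow> v \<xi> powr (p - 1 + s)"
      by (simp add: powr_add)
    then show ?case
      unfolding F_def
      by (intro tendsto_ennrealI tendsto_add tendsto_mult_left tendsto_mult_right g_lim(2)[OF elim])
  qed
  \<comment> \<open>Fatou's lemma is the tool on this side because the finiteness of the limiting
    gradient integral is itself part of the conclusion, so no majorant is at hand.\<close>
  have "integral\<^sup>N M ?F = (\<integral>\<^sup>+\<xi>. liminf (\<lambda>n. F n \<xi>) \<partial>M)"
    by (intro nn_integral_cong_AE, use F_lim in eventually_elim) (simp add: lim_imp_Liminf)
  also have "\<dots> \<le> liminf (\<lambda>n. integral\<^sup>N M (F n))"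
    by (rule nn_integral_liminf) measurable
  also have "\<dots> \<le> liminf (\<lambda>n. integral\<^sup>N M (H n))"
  proof (rule Liminf_mono, rule always_eventually, rule allI)
    show "integral\<^sup>N M (F n) \<le> integral\<^sup>N M (H n)" for n
      unfolding F_def[abs_def] H_def[abs_def] M_def
      by (rule subsolution_test_inequality[OF assms(1,2) sub pos \<phi> g g_pos g_le])
  qed
  also have "\<dots> = integral\<^sup>N M ?G"
  proof (rule lim_imp_Liminf)
    show "(\<lambda>n. integral\<^sup>N M (H n)) \<longlonglongrightarrow> integral\<^sup>N M ?G"
      by (rule nn_integral_dominated_convergence[OF _ _ _ H_le w H_lim]) (auto simp: w_def)
  qed simp
  finally show ?thesis
    by (simp add: M_def)
qed simp

section \<open>Approximating the power \<open>v\<^sup>s\<close>\<close>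

text \<open>The two half-lines meet only at \<open>a\<close>, where values and slopes agree, so the
  one-sided derivatives fit together.\<close>

lemma has_real_derivative_glue:
  fixes f h :: "real \<Rightarrow> real"
  assumes f: "\<And>x. x \<le> a \<Longrightarrow> (f has_real_derivative f' x) (at x)"
    and h: "\<And>x. a \<le> x \<Longrightarrow> (h has_real_derivative h' x) (at x)"
    and "f a = h a" "f' a = h' a"
  shows "((\<lambda>x. if x \<le> a then f x else h x) has_real_derivative (if x \<le> a then f' x else h' x)) (at x)"
proof -
  have "((\<lambda>x. if x \<in> {..a} then f x else h x) has_vector_derivative
      (if x \<in> {..a} then f' x else h' x)) (at x within UNIV)"
  proof (rule has_vector_derivative_If_within_closures[where T = "{a..}"])
    show "UNIV = {..a} \<union> {a..}"
      by auto
    note vec = has_vector_derivative_at_within[OF iffD1[OF has_real_derivative_iff_has_vector_derivative]]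
    show "(f has_vector_derivative f' x) (at x within {..a} \<union> closure {..a} \<inter> closure {a..})"
      if "x \<in> {..a} \<union> closure {..a} \<inter> closure {a..}"
      by (rule vec[OF f]) (use that in auto)
    show "(h has_vector_derivative h' x) (at x within {a..} \<union> closure {..a} \<inter> closure {a..})"
      if "x \<in> {a..} \<union> closure {..a} \<inter> closure {a..}"
      by (rule vec[OF h]) (use that in auto)
  qed (use assms(3,4) in auto)
  then show ?thesis
    unfolding has_real_derivative_iff_has_vector_derivative atMost_iff .
qed

text \<open>
  For \<open>s \<le> 1\<close> the derivative of \<open>x\<^sup>s\<close> blows up only at \<open>0\<close>, so a shift by \<open>d\<^sub>n\<close> suffices; the approximants of
  \<open>v\<close> may be negative, whence the linear continuation of \<open>g\<close> to the left.
\<close>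

lemma subsolution_inequality_le_1:
  fixes \<Omega> :: "'n::finite heis set"
  assumes "open \<Omega>" "1 < p" "0 < s" "s \<le> 1" and sub: "subsolution p lam \<Omega> v Dv"
    and pos: "AE \<xi> in lebesgue_on \<Omega>. 0 < v \<xi>"
    and \<phi>: "\<phi> \<in> C01 \<Omega>" "\<And>\<xi>. 0 \<le> \<phi> \<xi>"
  shows "(\<integral>\<^sup>+\<xi>. ennreal (1 / p * (s * v \<xi> powr (s - 1) * \<phi> \<xi> powr p * norm (Dv \<xi>) powr p)
        + max (- lam) 0 * (v \<xi> powr (p - 1 + s) * \<phi> \<xi> powr p)) \<partial>lebesgue_on \<Omega>)
    \<le> (\<integral>\<^sup>+\<xi>. ennreal (p powr (p - 1) * (s powr (1 - p) * v \<xi> powr (p - 1 + s) * norm (hgrad \<phi> \<xi>) powr p)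
        + max lam 0 * (v \<xi> powr (p - 1 + s) * \<phi> \<xi> powr p)) \<partial>lebesgue_on \<Omega>)"
proof -
  define d where "d n = inverse (real (Suc n))" for n
  \<comment> \<open>The linear piece is the tangent of \<open>(x + d n) powr s\<close> at
    zero.\<close>
  define g where "g n x = (if x \<le> 0 then d n powr s + s * d n powr (s - 1) * x else (x + d n) powr s)" for n x
  define g' where "g' n x = s * (max x 0 + d n) powr (s - 1)" for n x
  have d: "0 < d n" "d n \<le> 1" for n
    by (auto simp: d_def inverse_le_1_iff)
  have d_lim: "d \<longlonglongrightarrow> 0"
    unfolding d_def[abs_def] by (rule LIMSEQ_inverse_real_of_nat)
  have g'_eq: "g' n x = (if x \<le> 0 then s * d n powr (s - 1) else s * (x + d n) powr (s - 1))" for n x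
    by (simp add: g'_def max_def)
  have g_eq: "g n x = (x + d n) powr s" and g'_pos_eq: "g' n x = s * (x + d n) powr (s - 1)" if "0 < x" for n x
    using that by (auto simp: g_def g'_def)
  show ?thesis
  \<comment> \<open>\<open>L\<close> is the slope at zero, the largest one since
    \<open>s \<le> 1\<close>. The value \<open>1 / s\<close> of \<open>c\<close> comes from
    \<open>x + d n \<le> 1 + x\<close>. \<open>B\<close> covers the factor
    \<open>s powr (1 - p)\<close> of the first domination and the factor 1 of the second.\<close>
  proof (rule subsolution_limit_inequality[OF assms(1-3) sub pos \<phi>, where g = g and g' = g'
        and L = "\<lambda>n. s * d n powr (s - 1)" and c = "1 / s" and B = "s powr (1 - p) + 1"])
    show "(g n has_real_derivative g' n x) (at x)" for n x
      unfolding g_def[abs_def] g'_eq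
    proof (rule has_real_derivative_glue)
      fix x :: real
      show "((\<lambda>x. d n powr s + s * d n powr (s - 1) * x) has_real_derivative s * d n powr (s - 1)) (at x)"
        by (auto intro!: derivative_eq_intros)
      assume "0 \<le> x"
      then have "0 < x + d n"
        using d[of n] by linarith
      then show "((\<lambda>x. (x + d n) powr s) has_real_derivative s * (x + d n) powr (s - 1)) (at x)"
        by (auto intro!: derivative_eq_intros)
    qed auto
    have "max x 0 + d n \<noteq> 0" for n x
      using d(1)[of n] by (auto simp: max_def add_eq_0_iff2)
    then show "continuous_on UNIV (g' n)" for n
      unfolding g'_def[abs_def] by (intro continuous_intros) auto
    show "\<bar>g' n x\<bar> \<le> s * d n powr (s - 1)" for n x
      using d[of n] assms(3,4) by (auto simp: g'_def intro!: powr_mono2')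
    show "0 < g' n x" "0 \<le> g n x" if "0 < x" for n x
      using that d(1)[of n] assms(3) by (auto simp: g_eq g'_pos_eq)
    show "g n x \<le> 1 / s * ((1 + x) * g' n x)" if "0 < x" for n x
    proof -
      have "g n x = (x + d n) * (x + d n) powr (s - 1)"
        using that d(1)[of n] by (simp add: g_eq powr_diff)
      also have "\<dots> \<le> (1 + x) * (x + d n) powr (s - 1)"
        using d(2)[of n] by (intro mult_right_mono) auto
      finally show ?thesis
        using that assms(3) by (simp add: g'_pos_eq)
    qed
    show "(\<lambda>n. g n x) \<longlonglongrightarrow> x powr s" if "0 < x" for x
    proof -
      have "(\<lambda>n. (x + d n) powr s) \<longlonglongrightarrow> (x + 0) powr s"
        using that d_lim by (intro tendsto_intros) auto
      then show ?thesis
        using that by (simp add: g_eq)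
    qed
    show "(\<lambda>n. g' n x) \<longlonglongrightarrow> s * x powr (s - 1)" if "0 < x" for x
    proof -
      have "(\<lambda>n. s * (x + d n) powr (s - 1)) \<longlonglongrightarrow> s * (x + 0) powr (s - 1)"
        using that d_lim by (intro tendsto_intros) auto
      then show ?thesis
        using that by (simp add: g'_pos_eq)
    qed
    \<comment> \<open>Here \<open>s \<le> 1\<close> gives \<open>p - 1 + s \<le> p\<close>, and the
      base \<open>1 + x\<close> exceeds 1; this absorbs the shift, as
      \<open>d n \<le> 1\<close>.\<close>
    have le: "y powr (p - 1 + s) \<le> (1 + x) powr p" if "0 < y" "y \<le> 1 + x" "0 < x" for x y
    proof -
      have "y powr (p - 1 + s) \<le> (1 + x) powr (p - 1 + s)"
        using that assms(2,3) by (intro powr_mono2) auto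
      also have "\<dots> \<le> (1 + x) powr p"
        using that assms(4) by (intro powr_mono) auto
      finally show ?thesis .
    qed
    show "g n x powr p * g' n x powr (1 - p) \<le> (s powr (1 - p) + 1) * (x powr (p - 1 + s) + (1 + x) powr p)"
      if "0 < x" for n x
    proof -
      have "g n x powr p * g' n x powr (1 - p) =
          s powr (1 - p) * ((x + d n) powr (s * p) * (x + d n) powr ((s - 1) * (1 - p)))"
        using that assms(3) by (simp add: g_eq g'_pos_eq powr_mult powr_powr)
      also have "(x + d n) powr (s * p) * (x + d n) powr ((s - 1) * (1 - p)) = (x + d n) powr (p - 1 + s)"
        by (simp flip: powr_add add: algebra_simps)
      also have "s powr (1 - p) * \<dots> \<le> (s powr (1 - p) + 1) * (x powr (p - 1 + s) + (1 + x) powr p)"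
        using le[of "x + d n" x] that d[of n] by (intro mult_mono) (auto intro: add_increasing)
      finally show ?thesis .
    qed
    show "x powr (p - 1) * g n x \<le> (s powr (1 - p) + 1) * (x powr (p - 1 + s) + (1 + x) powr p)"
      if "0 < x" for n x
    proof -
      have "x powr (p - 1) * g n x \<le> (x + d n) powr (p - 1) * (x + d n) powr s"
        using that d(1)[of n] assms(2) by (auto simp: g_eq intro!: mult_right_mono powr_mono2)
      also have "\<dots> = 1 * (x + d n) powr (p - 1 + s)"
        by (simp add: powr_add)
      also have "\<dots> \<le> (s powr (1 - p) + 1) * (x powr (p - 1 + s) + (1 + x) powr p)"
        using le[of "x + d n" x] that d[of n] by (intro mult_mono) (auto intro: add_increasing)
      finally show ?thesis .
    qed
  qed (use assms(3) in auto)
qed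

text \<open>
  For \<open>s > 1\<close> the power is continued beyond \<open>m\<^sub>n\<close> by its tangent: a bounded truncation would have
  \<open>g' = 0\<close> there, whereas convexity gives \<open>g(x) \<le> x g'(x)\<close> and hence the domination.
\<close>

lemma subsolution_inequality_gt_1:
  fixes \<Omega> :: "'n::finite heis set"
  assumes "open \<Omega>" "1 < p" "1 < s" and sub: "subsolution p lam \<Omega> v Dv"
    and pos: "AE \<xi> in lebesgue_on \<Omega>. 0 < v \<xi>"
    and \<phi>: "\<phi> \<in> C01 \<Omega>" "\<And>\<xi>. 0 \<le> \<phi> \<xi>"
  shows "(\<integral>\<^sup>+\<xi>. ennreal (1 / p * (s * v \<xi> powr (s - 1) * \<phi> \<xi> powr p * norm (Dv \<xi>) powr p)
        + max (- lam) 0 * (v \<xi> powr (p - 1 + s) * \<phi> \<xi> powr p)) \<partial>lebesgue_on \<Omega>)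
    \<le> (\<integral>\<^sup>+\<xi>. ennreal (p powr (p - 1) * (s powr (1 - p) * v \<xi> powr (p - 1 + s) * norm (hgrad \<phi> \<xi>) powr p)
        + max lam 0 * (v \<xi> powr (p - 1 + s) * \<phi> \<xi> powr p)) \<partial>lebesgue_on \<Omega>)"
proof -
  define m where "m n = real (Suc n)" for n
  define g where "g n x = (if x \<le> m n then max x 0 powr s else m n powr s + s * m n powr (s - 1) * (x - m n))" for n x
  define g' where "g' n x = s * min (max x 0) (m n) powr (s - 1)" for n x
  have m: "0 < m n" for n
    by (simp add: m_def)
  have g'_eq: "g' n x = (if x \<le> m n then s * max x 0 powr (s - 1) else s * m n powr (s - 1))" for n x
    using m[of n] by (auto simp: g'_def min_def max_def)
  have g_nonneg: "0 \<le> g n x" for n x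
    using assms(3) by (auto simp: g_def intro!: add_nonneg_nonneg mult_nonneg_nonneg)
  have g_le: "g n x \<le> x * g' n x" if "0 < x" for n x
  proof (cases "x \<le> m n")
    case True
    have "1 * x powr s \<le> s * x powr s"
      using assms(3) by (intro mult_right_mono) auto
    then show ?thesis
      using True that by (simp add: g_def g'_eq powr_diff)
  next
    case False
    \<comment> \<open>On the tangent, \<open>g n x = x * g' n x - (s - 1) * m n powr s\<close>, and
      the subtracted term is nonnegative.\<close>
    have "1 * m n powr s \<le> s * m n powr s"
      using assms(3) by (intro mult_right_mono) auto
    moreover have "m n powr s = m n * m n powr (s - 1)"
      using m[of n] by (simp add: powr_diff)
    ultimately show ?thesis
      using False by (simp add: g_def g'_eq algebra_simps)
  qed
  have g'_le: "g' n x \<le> s * x powr (s - 1)" and g'_pos: "0 < g' n x" if "0 < x" for n x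
    using that assms(3) m[of n] by (auto simp: g'_def intro!: powr_mono2)
  \<comment> \<open>Both dominations reduce to this quantity through
    \<open>g n x \<le> x * g' n x\<close>: one via \<open>(x * g') powr p * g' powr (1 - p)\<close>,
    the other via \<open>x powr (p - 1) * (x * g')\<close>.\<close>
  have dom: "x powr p * g' n x \<le> s * (x powr (p - 1 + s) + (1 + x) powr p)" if "0 < x" for n x
  proof -
    have "x powr p * g' n x \<le> x powr p * (s * x powr (s - 1))"
      using g'_le[OF that] by (intro mult_left_mono) auto
    also have "\<dots> = s * (x powr (p - 1 + s) + 0)"
      using that by (simp flip: powr_add add: algebra_simps)
    also have "\<dots> \<le> s * (x powr (p - 1 + s) + (1 + x) powr p)"
      using assms(3) by (intro mult_left_mono add_left_mono) auto
    finally show ?thesis .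
  qed
  \<comment> \<open>At a fixed \<open>x\<close> the approximation is exact from some
    \<open>n\<close> on, so both limits are limits of eventually constant sequences.\<close>
  have ev: "eventually (\<lambda>n. x \<le> m n) sequentially" for x
    using filterlim_real_sequentially unfolding m_def
    by (subst eventually_sequentially_Suc) (simp add: filterlim_at_top)
  show ?thesis
  \<comment> \<open>\<open>L\<close> is the tangent slope, the largest one since
    \<open>s > 1\<close>; \<open>B = s\<close> comes from
    \<open>g' n x \<le> s * x powr (s - 1)\<close>.\<close>
  proof (rule subsolution_limit_inequality[OF assms(1,2) _ sub pos \<phi>, where g = g and g' = g'
        and L = "\<lambda>n. s * m n powr (s - 1)" and c = 1 and B = s])
    show "(g n has_real_derivative g' n x) (at x)" for n x
      unfolding g_def[abs_def] g'_eq
    proof (rule has_real_derivative_glue)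
      fix x :: real
      show "((\<lambda>x. max x 0 powr s) has_real_derivative s * max x 0 powr (s - 1)) (at x)"
        by (rule has_real_derivative_pos_part_powr[OF assms(3)])
      show "((\<lambda>x. m n powr s + s * m n powr (s - 1) * (x - m n)) has_real_derivative s * m n powr (s - 1)) (at x)"
        by (auto intro!: derivative_eq_intros)
    qed (use m[of n] in auto)
    show "continuous_on UNIV (g' n)" for n
      unfolding g'_def[abs_def] using assms(3) m[of n]
      by (intro continuous_intros continuous_on_powr') auto
    show "\<bar>g' n x\<bar> \<le> s * m n powr (s - 1)" for n x
      using assms(3) m[of n] by (auto simp: g'_def intro!: powr_mono2)
    show "0 < g' n x" "0 \<le> g n x" if "0 < x" for n x
      using g'_pos[OF that] g_nonneg by auto
    show "g n x \<le> 1 * ((1 + x) * g' n x)" if "0 < x" for n x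
      using g_le[OF that, of n] g'_pos[OF that, of n] by (simp add: distrib_right)
    show "(\<lambda>n. g n x) \<longlonglongrightarrow> x powr s" if "0 < x" for x
      by (rule tendsto_eventually, rule eventually_mono[OF ev[of x]]) (use that in \<open>simp add: g_def\<close>)
    show "(\<lambda>n. g' n x) \<longlonglongrightarrow> s * x powr (s - 1)" if "0 < x" for x
      by (rule tendsto_eventually, rule eventually_mono[OF ev[of x]]) (use that in \<open>simp add: g'_eq\<close>)
    show "g n x powr p * g' n x powr (1 - p) \<le> s * (x powr (p - 1 + s) + (1 + x) powr p)" if "0 < x" for n x
    proof -
      have "g n x powr p * g' n x powr (1 - p) \<le> (x * g' n x) powr p * g' n x powr (1 - p)"
        using g_le[OF that] g_nonneg assms(2) by (intro mult_right_mono powr_mono2) auto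
      also have "\<dots> = x powr p * g' n x"
        using g'_pos[OF that, of n] that by (simp add: powr_mult powr_diff)
      finally show ?thesis
        using dom[OF that] by (rule order_trans)
    qed
    show "x powr (p - 1) * g n x \<le> s * (x powr (p - 1 + s) + (1 + x) powr p)" if "0 < x" for n x
    proof -
      have "x powr (p - 1) * g n x \<le> x powr (p - 1) * (x * g' n x)"
        using g_le[OF that] by (intro mult_left_mono) auto
      also have "\<dots> = x powr p * g' n x"
        using that by (simp add: powr_diff)
      finally show ?thesis
        using dom[OF that] by (rule order_trans)
    qed
  qed (use assms(3) in auto)
qed

section \<open>Passage to signed coefficients and extended real values\<close>

lemma enn2ereal_le_of_weighted_sum:
  fixes I J K :: ennreal
  assumes "0 < a" "0 < b"
    and le: "ennreal a * I + ennreal (max (- l) 0) * K \<le> ennreal b * J + ennreal (max l 0) * K"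
  shows "enn2ereal I \<le> ereal (b / a) * enn2ereal J + ereal (l / a) * enn2ereal K"
\<comment> \<open>In this case the right-hand side is infinite, also when \<open>l < 0\<close> and
  \<open>K\<close> is infinite, since \<open>ereal\<close> evaluates
  \<open>\<infinity> - \<infinity>\<close> to \<open>\<infinity>\<close>.\<close>
proof (cases "J = top \<or> (0 < l \<and> K = top)")
  case True
  then show ?thesis
    using assms(1,2) by (cases K rule: ennreal_cases; cases J rule: ennreal_cases) auto
next
  case False
  then obtain j where j: "J = ennreal j" "0 \<le> j"
    by (cases J rule: ennreal_cases) auto
  have "ennreal b * J + ennreal (max l 0) * K < top"
    using False j by (cases "0 < l") (auto simp: ennreal_mult_less_top max_def top.not_eq_extremum)
  with le have fin: "ennreal a * I < top" "ennreal (max (- l) 0) * K < top"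
    by (auto simp: less_top[symmetric] top_unique)
  then obtain i where i: "I = ennreal i" "0 \<le> i"
    using assms(1) by (cases I rule: ennreal_cases) (auto simp: ennreal_mult_top)
  show ?thesis
  \<comment> \<open>For \<open>l = 0\<close> the integral \<open>K\<close> may still be infinite,
    but zero times infinity is zero. For \<open>l \<noteq> 0\<close> it is finite: by the case
    assumption if \<open>l > 0\<close>, and by the finite left-hand side if
    \<open>l < 0\<close>.\<close>
  proof (cases "l = 0")
    case True
    have "a * i \<le> b * j"
      using le True i j assms(1,2) by (simp flip: ennreal_mult)
    then show ?thesis
      using True i j assms(1) by (simp add: enn2ereal_ennreal field_simps flip: zero_ereal_def)
  next
    case l: False
    then obtain k where k: "K = ennreal k" "0 \<le> k"
      using False fin(2) by (cases K rule: ennreal_cases) (auto simp: ennreal_mult_top max_def split: if_splits)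
    have "a * i + max (- l) 0 * k \<le> b * j + max l 0 * k"
      using le i j k assms(1,2) by (simp flip: ennreal_mult ennreal_plus)
    moreover have "l * k = max l 0 * k - max (- l) 0 * k"
      by (simp add: max_def)
    ultimately have "a * i \<le> b * j + l * k"
      by linarith
    then show ?thesis
      using i j k assms(1) by (simp add: enn2ereal_ennreal field_simps)
  qed
qed

lemma subsolution_ext_integral_inequality:
  fixes \<Omega> :: "'n::finite heis set"
  assumes "open \<Omega>" "1 < p" and sub: "subsolution p lam \<Omega> v Dv"
    and pos: "AE \<xi> in lebesgue_on \<Omega>. 0 < v \<xi>"
    and \<phi>: "\<phi> \<in> C01 \<Omega>" "\<And>\<xi>. 0 \<le> \<phi> \<xi>" and "p - 1 < q"
  shows "ext_integral \<Omega> (\<lambda>\<xi>. v \<xi> powr (q - p) * \<phi> \<xi> powr p * norm (Dv \<xi>) powr p)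
    \<le> ereal ((p / (q - p + 1)) powr p) * ext_integral \<Omega> (\<lambda>\<xi>. v \<xi> powr q * norm (hgrad \<phi> \<xi>) powr p)
      + ereal (lam * p / (q - p + 1)) * ext_integral \<Omega> (\<lambda>\<xi>. v \<xi> powr q * \<phi> \<xi> powr p)"
proof -
  define s where "s = q - p + 1"
  have s: "0 < s" "s - 1 = q - p" "p - 1 + s = q"
    using assms(7) by (auto simp: s_def)
  have O: "\<Omega> \<in> sets lebesgue"
    using assms(1) by auto
  have S: "S0_grad p \<Omega> v Dv"
    using sub by (simp add: subsolution_def)
  have [measurable]: "v \<in> borel_measurable (lebesgue_on \<Omega>)" "Dv \<in> borel_measurable (lebesgue_on \<Omega>)"
    "\<phi> \<in> borel_measurable (lebesgue_on \<Omega>)" "hgrad \<phi> \<in> borel_measurable (lebesgue_on \<Omega>)"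
    using S0_grad_approx(2,3)[OF S] C01_measurable[OF \<phi>(1) O] by auto
  let ?I = "\<lambda>\<xi>. v \<xi> powr (q - p) * \<phi> \<xi> powr p * norm (Dv \<xi>) powr p"
  let ?J = "\<lambda>\<xi>. v \<xi> powr q * norm (hgrad \<phi> \<xi>) powr p"
  let ?K = "\<lambda>\<xi>. v \<xi> powr q * \<phi> \<xi> powr p"
  have lin: "(\<integral>\<^sup>+\<xi>. ennreal (a * X \<xi> + b * ?K \<xi>) \<partial>lebesgue_on \<Omega>) =
      ennreal a * (\<integral>\<^sup>+\<xi>. ennreal (X \<xi>) \<partial>lebesgue_on \<Omega>) + ennreal b * (\<integral>\<^sup>+\<xi>. ennreal (?K \<xi>) \<partial>lebesgue_on \<Omega>)"
    if [measurable]: "X \<in> borel_measurable (lebesgue_on \<Omega>)" and "\<And>\<xi>. 0 \<le> X \<xi>" "0 \<le> a" "0 \<le> b" for a b X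
    using that(2-) by (simp add: nn_integral_add nn_integral_cmult ennreal_mult)
  have "(\<integral>\<^sup>+\<xi>. ennreal (1 / p * (s * v \<xi> powr (s - 1) * \<phi> \<xi> powr p * norm (Dv \<xi>) powr p)
        + max (- lam) 0 * (v \<xi> powr (p - 1 + s) * \<phi> \<xi> powr p)) \<partial>lebesgue_on \<Omega>)
    \<le> (\<integral>\<^sup>+\<xi>. ennreal (p powr (p - 1) * (s powr (1 - p) * v \<xi> powr (p - 1 + s) * norm (hgrad \<phi> \<xi>) powr p)
        + max lam 0 * (v \<xi> powr (p - 1 + s) * \<phi> \<xi> powr p)) \<partial>lebesgue_on \<Omega>)"
    using subsolution_inequality_le_1[OF assms(1,2) s(1) _ sub pos \<phi>]
      subsolution_inequality_gt_1[OF assms(1,2) _ sub pos \<phi>, of s] by (cases "s \<le> 1") auto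
  then have "(\<integral>\<^sup>+\<xi>. ennreal (s / p * ?I \<xi> + max (- lam) 0 * ?K \<xi>) \<partial>lebesgue_on \<Omega>)
    \<le> (\<integral>\<^sup>+\<xi>. ennreal ((p powr (p - 1) * s powr (1 - p)) * ?J \<xi> + max lam 0 * ?K \<xi>) \<partial>lebesgue_on \<Omega>)"
    unfolding s(2,3) by (simp add: mult_ac)
  moreover have "(\<integral>\<^sup>+\<xi>. ennreal (s / p * ?I \<xi> + max (- lam) 0 * ?K \<xi>) \<partial>lebesgue_on \<Omega>) =
      ennreal (s / p) * (\<integral>\<^sup>+\<xi>. ennreal (?I \<xi>) \<partial>lebesgue_on \<Omega>)
      + ennreal (max (- lam) 0) * (\<integral>\<^sup>+\<xi>. ennreal (?K \<xi>) \<partial>lebesgue_on \<Omega>)"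
    by (rule lin) (use s(1) assms(2) in auto)
  moreover have "(\<integral>\<^sup>+\<xi>. ennreal ((p powr (p - 1) * s powr (1 - p)) * ?J \<xi> + max lam 0 * ?K \<xi>) \<partial>lebesgue_on \<Omega>) =
      ennreal (p powr (p - 1) * s powr (1 - p)) * (\<integral>\<^sup>+\<xi>. ennreal (?J \<xi>) \<partial>lebesgue_on \<Omega>)
      + ennreal (max lam 0) * (\<integral>\<^sup>+\<xi>. ennreal (?K \<xi>) \<partial>lebesgue_on \<Omega>)"
    by (rule lin) auto
  ultimately have le: "ennreal (s / p) * (\<integral>\<^sup>+\<xi>. ennreal (?I \<xi>) \<partial>lebesgue_on \<Omega>)
      + ennreal (max (- lam) 0) * (\<integral>\<^sup>+\<xi>. ennreal (?K \<xi>) \<partial>lebesgue_on \<Omega>)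
    \<le> ennreal (p powr (p - 1) * s powr (1 - p)) * (\<integral>\<^sup>+\<xi>. ennreal (?J \<xi>) \<partial>lebesgue_on \<Omega>)
      + ennreal (max lam 0) * (\<integral>\<^sup>+\<xi>. ennreal (?K \<xi>) \<partial>lebesgue_on \<Omega>)"
    by (simp only:)
  have "enn2ereal (\<integral>\<^sup>+\<xi>. ennreal (?I \<xi>) \<partial>lebesgue_on \<Omega>) \<le>
      ereal (p powr (p - 1) * s powr (1 - p) / (s / p)) * enn2ereal (\<integral>\<^sup>+\<xi>. ennreal (?J \<xi>) \<partial>lebesgue_on \<Omega>)
      + ereal (lam / (s / p)) * enn2ereal (\<integral>\<^sup>+\<xi>. ennreal (?K \<xi>) \<partial>lebesgue_on \<Omega>)"
    by (rule enn2ereal_le_of_weighted_sum[OF _ _ le]) (use s(1) assms(2) in auto)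
  \<comment> \<open>Dividing by \<open>s / p\<close> raises the power of \<open>p\<close> to
    \<open>p\<close> and lowers that of \<open>s\<close> to \<open>- p\<close>.\<close>
  moreover have "p powr (p - 1) * s powr (1 - p) / (s / p) = (p / (q - p + 1)) powr p"
    using s(1) assms(2) by (simp add: powr_diff powr_divide flip: s_def)
  ultimately show ?thesis
    by (simp add: ext_integral_def flip: s_def)
qed

theorem corollary3p3:
  fixes \<Omega> :: "'n::finite heis set"
    and p lam :: real
    and v :: "'n heis \<Rightarrow> real"
    and Dv :: "'n heis \<Rightarrow> 'n hvec"
  assumes "open \<Omega>"
    and "1 < p"
    and "subsolution p lam \<Omega> v Dv"
    and "AE \<xi> in lebesgue_on \<Omega>. 0 < v \<xi>"
  shows "(\<forall>q > p - 1. \<forall>\<phi> \<in> C0inf \<Omega>. (\<forall>\<xi>. 0 \<le> \<phi> \<xi>) \<longrightarrow>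
            ext_integral \<Omega> (\<lambda>\<xi>. v \<xi> powr (q - p) * \<phi> \<xi> powr p * norm (Dv \<xi>) powr p)
              \<le> ereal ((p / (q - p + 1)) powr p)
                    * ext_integral \<Omega> (\<lambda>\<xi>. v \<xi> powr q * norm (hgrad \<phi> \<xi>) powr p)
                  + ereal (lam * p / (q - p + 1))
                    * ext_integral \<Omega> (\<lambda>\<xi>. v \<xi> powr q * \<phi> \<xi> powr p))
       \<and> (lam = 0 \<longrightarrow> (\<forall>\<phi> \<in> C0inf \<Omega>. (\<forall>\<xi>. 0 \<le> \<phi> \<xi>) \<longrightarrow>
            ext_integral \<Omega> (\<lambda>\<xi>. \<phi> \<xi> powr p * norm (Dv \<xi>) powr p)
              \<le> ereal (p powr p) * ext_integral \<Omega> (\<lambda>\<xi>. v \<xi> powr p * norm (hgrad \<phi> \<xi>) powr p)))"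
proof -
  have C01: "\<phi> \<in> C01 \<Omega>" if "\<phi> \<in> C0inf \<Omega>" for \<phi> :: "'n heis \<Rightarrow> real"
    using that by (simp add: C01_def C0inf_def del: Ck.simps One_nat_def)
  note main = subsolution_ext_integral_inequality[OF assms C01]
  show ?thesis
  proof (intro conjI allI impI ballI)
    fix \<phi> :: "'n heis \<Rightarrow> real"
    assume "lam = 0" and \<phi>: "\<phi> \<in> C0inf \<Omega>" "\<forall>\<xi>. 0 \<le> \<phi> \<xi>"
    \<comment> \<open>The factor \<open>v \<xi> powr 0\<close> is 1 only where \<open>v\<close> is
      nonzero, as \<open>0 powr 0 = 0\<close>; positivity almost everywhere removes it under the
      integral.\<close>
    have "AE \<xi> in lebesgue_on \<Omega>. v \<xi> powr (p - p) * \<phi> \<xi> powr p * norm (Dv \<xi>) powr p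
        = \<phi> \<xi> powr p * norm (Dv \<xi>) powr p"
      using assms(4) by eventually_elim simp
    then have "ext_integral \<Omega> (\<lambda>\<xi>. v \<xi> powr (p - p) * \<phi> \<xi> powr p * norm (Dv \<xi>) powr p)
        = ext_integral \<Omega> (\<lambda>\<xi>. \<phi> \<xi> powr p * norm (Dv \<xi>) powr p)"
      unfolding ext_integral_def by (intro arg_cong[of _ _ enn2ereal] nn_integral_cong_AE) auto
    then show "ext_integral \<Omega> (\<lambda>\<xi>. \<phi> \<xi> powr p * norm (Dv \<xi>) powr p)
        \<le> ereal (p powr p) * ext_integral \<Omega> (\<lambda>\<xi>. v \<xi> powr p * norm (hgrad \<phi> \<xi>) powr p)"
      using main[OF \<phi>(1), of p] \<phi>(2) \<open>lam = 0\<close> by (simp add: zero_ereal_def[symmetric])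
  qed (use main in auto)
qed

end
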